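(* Let $0 < R \leq \infty$, $I = [0, R)$ or $(-R,R)$, and $f: I \rightarrow \mathbb{R}$. Fix integers $1 \leq k < n$, and suppose $f$ admits at least $k$ nonzero derivatives at $0$. \begin{enumerate} \item Then $f[-] : \mathbb{P}_n^1(I) \to \mathbb{S}_n^k$ if and only if $f$ is a polynomial with exactly $k$ nonzero coefficients. \item Similarly, $f[-] : \mathbb{P}_n^1(I) \to \mathbb{P}_n^k$ if and only if $f$ is a polynomial with exactly $k$ nonzero coefficients which are all positive. \item Suppose $f$ admits at least $n-1$ nonzero derivatives at zero, of orders $0 \leq m_1 < \cdots < m_{n-1}$. If $f[-] : \mathbb{P}_n^1(I) \to \mathbb{P}_n$, then writing $f$ in its Taylor expansion at $0$: $$f(x) = \sum_{i=1}^{n-1} \frac{f^{(m_i)}(0)}{m_i!}\, x^{m_i} + x^{m_{n-1}} h(x),$$ the Taylor coefficients $\frac{f^{(m_i)}(0)}{m_i!}$ are positive, and $h([0,R)) \subset [0,\infty)$. \end{enumerate}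
   Context: For $J \subset \mathbb{R}$, $\mathbb{S}_n(J)$ is the set of $n \times n$ real symmetric matrices with entries in $J$, and $\mathbb{P}_n(J) \subset \mathbb{S}_n(J)$ is the subset of positive semidefinite matrices. $\mathbb{S}_n^k(J)$ and $\mathbb{P}_n^k(J)$ denote the respective subsets of matrices of rank at most $k$. When $J = \mathbb{R}$ it is omitted from the notation. For a matrix $A=(a_{ij})$ with entries in the domain of $f$, $f[A] := (f(a_{ij}))$ (entrywise application). The notation $f[-]: X \to Y$ means that $f[A] \in Y$ for all $A \in X$. By convention the derivatives of $f$ include the zeroth derivative, which is $f$ itself; for example, $f(x)=1+x$ has two nonzero derivatives at the origin. In (3), $h$ is the real-valued remainder function on $I$ in the displayed expansion.
   Formalization: The "only if" directions of (1) and (2) exclude n = 2 with I = (-R,R), where they fail (f(x)=x for x>-c, f(x)=-x for x≤-c); in (3) the m_i are taken to be the first n-1 orders of nonzero derivatives, as the displayed Taylor expansion requires. *)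

theory Defs
  imports "HOL-Analysis.Analysis" "HOL-Computational_Algebra.Polynomial"
begin

definition sym_mats :: "real set \<Rightarrow> (real^'n^'n) set" where
  "sym_mats J = {A. transpose A = A \<and> (\<forall>i j. A $ i $ j \<in> J)}"

definition psd_mats :: "real set \<Rightarrow> (real^'n^'n) set" where
  "psd_mats J = {A \<in> sym_mats J. \<forall>x. 0 \<le> x \<bullet> (A *v x)}"

definition sym_mats_rank_le :: "nat \<Rightarrow> real set \<Rightarrow> (real^'n^'n) set" where
  "sym_mats_rank_le k J = {A \<in> sym_mats J. rank A \<le> k}"

definition psd_mats_rank_le :: "nat \<Rightarrow> real set \<Rightarrow> (real^'n^'n) set" where
  "psd_mats_rank_le k J = {A \<in> psd_mats J. rank A \<le> k}"

definition entrywise :: "(real \<Rightarrow> real) \<Rightarrow> real^'n^'n \<Rightarrow> real^'n^'n" where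
  "entrywise f A = (\<chi> i j. f (A $ i $ j))"

text \<open>
  \<open>has_nth_derivative m f S x D\<close>: the derivative of order \<open>m\<close> at \<open>x\<close> of \<open>f\<close>, regarded as a function
  on \<open>S\<close> only, exists and equals \<open>D\<close>. As usual, order \<open>m + 1\<close> at \<open>x\<close> requires order \<open>m\<close> at all
  points of \<open>S\<close> near \<open>x\<close>. For \<open>S = [0, R)\<close> derivatives at \<open>0\<close> are one-sided.
\<close>
primrec has_nth_derivative ::
    "nat \<Rightarrow> (real \<Rightarrow> real) \<Rightarrow> real set \<Rightarrow> real \<Rightarrow> real \<Rightarrow> bool" where
  "has_nth_derivative 0 f S x D \<longleftrightarrow> f x = D"
| "has_nth_derivative (Suc m) f S x D \<longleftrightarrow>
     (\<exists>g. (\<forall>\<^sub>F y in nhds x. y \<in> S \<longrightarrow> has_nth_derivative m f S y (g y)) \<and>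
          (g has_real_derivative D) (at x within S))"

lemma has_nth_derivative_unique:
  assumes "\<And>y. y \<in> S \<Longrightarrow> at y within S \<noteq> bot" and "x \<in> S"
    and "has_nth_derivative m f S x D" and "has_nth_derivative m f S x E"
  shows "D = E"
  using assms(2-)
proof (induction m arbitrary: x D E)
  case 0
  then show ?case by simp
next
  case (Suc m)
  from Suc.prems obtain g h where
    g: "\<forall>\<^sub>F y in nhds x. y \<in> S \<longrightarrow> has_nth_derivative m f S y (g y)"
       "(g has_real_derivative D) (at x within S)" and
    h: "\<forall>\<^sub>F y in nhds x. y \<in> S \<longrightarrow> has_nth_derivative m f S y (h y)"
       "(h has_real_derivative E) (at x within S)"
    by auto
  have ev: "\<forall>\<^sub>F y in nhds x. y \<in> S \<longrightarrow> g y = h y"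
    using g(1) h(1) by eventually_elim (use Suc.IH in blast)
  have eq: "g x = h x"
    using eventually_nhds_x_imp_x[OF ev] Suc.prems(1) by blast
  have ev': "\<forall>\<^sub>F y in at x within S. g y = h y"
    using ev unfolding eventually_at_filter by eventually_elim auto
  have "(h has_real_derivative D) (at x within S)"
    using g(2) has_field_derivative_cong_eventually[OF ev' eq] by simp
  then show ?case
    using h(2) assms(1)[OF Suc.prems(1)] unfolding has_field_derivative_iff
    by (blast intro: tendsto_unique)
qed

text \<open>\<open>f\<close> agrees on \<open>S\<close> with a polynomial having exactly \<open>k\<close> nonzero coefficients,
  respectively one all of whose nonzero coefficients are moreover positive.\<close>
definition polynomial_with_coeffs :: "nat \<Rightarrow> real set \<Rightarrow> (real \<Rightarrow> real) \<Rightarrow> bool" where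
  "polynomial_with_coeffs k S f \<longleftrightarrow>
     (\<exists>p. (\<forall>x\<in>S. f x = poly p x) \<and> card {i. coeff p i \<noteq> 0} = k)"

definition polynomial_with_pos_coeffs :: "nat \<Rightarrow> real set \<Rightarrow> (real \<Rightarrow> real) \<Rightarrow> bool" where
  "polynomial_with_pos_coeffs k S f \<longleftrightarrow>
     (\<exists>p. (\<forall>x\<in>S. f x = poly p x) \<and> card {i. coeff p i \<noteq> 0} = k \<and>
          (\<forall>i. coeff p i \<noteq> 0 \<longrightarrow> coeff p i > 0))"

text \<open>
  A rank-one preserver of \<open>2 \<times> 2\<close> matrices on a two-sided interval need not be a polynomial: a
  positive semidefinite \<open>2 \<times> 2\<close> matrix of rank at most one has nonnegative diagonal, and both its
  rank and its semidefiniteness are unaffected by the signs of the off-diagonal entry. Hence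
  necessity of polynomiality has to be restricted to \<open>[0, R)\<close> or to dimension at least three.
\<close>
definition sign_flip :: "real \<Rightarrow> real" where
  "sign_flip x = (if - 1 < x then x else - x)"

lemma sign_flip_derivative: "has_nth_derivative 1 sign_flip UNIV 0 1"
proof -
  have "(sign_flip has_real_derivative 1) (at 0)"
  proof (rule has_field_derivative_transform_within_open)
    show "((\<lambda>x::real. x) has_real_derivative 1) (at 0)" by simp
    show "open {- 1 <..< (1::real)}" by simp
  qed (auto simp: sign_flip_def)
  then show ?thesis by (auto intro: exI[of _ sign_flip])
qed

lemma sign_flip_not_polynomial: "\<not> polynomial_with_coeffs k UNIV sign_flip"
proof
  assume "polynomial_with_coeffs k UNIV sign_flip"
  then obtain p where p: "\<And>x. sign_flip x = poly p x"
    by (auto simp: polynomial_with_coeffs_def)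
  have "poly p x = x" if "0 < x" for x
    using p[of x] that by (simp add: sign_flip_def)
  then have "{0<..} \<subseteq> {x. poly (p - [:0, 1:]) x = 0}"
    by auto
  then have "infinite {x::real. poly (p - [:0, 1:]) x = 0}"
    using infinite_Ioi infinite_super by blast
  then have "p - [:0, 1:] = 0"
    using poly_roots_finite by blast
  then have "poly p (- 1) = - 1" by simp
  then show False using p[of "- 1"] by (simp add: sign_flip_def)
qed

lemma sign_flip_preserves:
  "entrywise sign_flip \<in>
     (psd_mats_rank_le 1 UNIV :: (real^2^2) set) \<rightarrow> psd_mats_rank_le 1 UNIV"
proof
  fix A :: "real^2^2"
  assume "A \<in> psd_mats_rank_le 1 UNIV"
  then have tr: "transpose A = A" and psd: "\<And>x. 0 \<le> x \<bullet> (A *v x)" and rk: "rank A \<le> 1"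
    by (auto simp: psd_mats_rank_le_def psd_mats_def sym_mats_def)
  have sym: "A $ 2 $ 1 = A $ 1 $ 2"
    using arg_cong[OF tr, of "\<lambda>M. M $ 1 $ 2"] by (simp add: transpose_def)
  have diag: "0 \<le> A $ i $ i" for i
    using psd[of "axis i 1"] by (simp add: inner_axis' matrix_vector_mul_component inner_axis)
  have "det A = 0"
    using rk by (simp add: det_eq_0_rank)
  then have det: "A $ 1 $ 1 * A $ 2 $ 2 = (A $ 1 $ 2)\<^sup>2"
    by (simp add: det_2 sym power2_eq_square)
  let ?B = "entrywise sign_flip A"
  have B: "?B $ i $ i = A $ i $ i" "?B $ 2 $ 1 = ?B $ 1 $ 2"
      "(?B $ 1 $ 2)\<^sup>2 = (A $ 1 $ 2)\<^sup>2" for i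
    using diag[of i] by (auto simp: entrywise_def sign_flip_def sym)
  have detB: "?B $ 1 $ 1 * ?B $ 2 $ 2 = (?B $ 1 $ 2)\<^sup>2"
    using B det by simp
  have "det ?B = 0"
    using B(2) detB by (simp add: det_2 power2_eq_square)
  then have "rank ?B \<le> 1"
    by (simp add: det_eq_0_rank)
  moreover have "transpose ?B = ?B"
    using B(2) by (simp add: vec_eq_iff forall_2 transpose_def)
  moreover have "0 \<le> x \<bullet> (?B *v x)" for x
  proof -
    define a b d where "a = ?B $ 1 $ 1" and "b = ?B $ 1 $ 2" and "d = ?B $ 2 $ 2"
    have ad: "0 \<le> a" "0 \<le> d" "a * d = b\<^sup>2"
      using diag[of 1] diag[of 2] detB by (simp_all add: a_def b_def d_def B(1))
    have eq: "x \<bullet> (?B *v x) = a * (x$1)\<^sup>2 + 2 * b * x$1 * x$2 + d * (x$2)\<^sup>2"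
      using B(2) by (simp add: a_def b_def d_def inner_vec_def matrix_vector_mult_def sum_2
          power2_eq_square algebra_simps)
    show ?thesis
    proof (cases "a = 0")
      case True
      then show ?thesis using ad eq by simp
    next
      case False
      have "a * (a * (x$1)\<^sup>2 + 2 * b * x$1 * x$2 + d * (x$2)\<^sup>2)
              = a\<^sup>2 * (x$1)\<^sup>2 + 2 * a * b * x$1 * x$2 + (a * d) * (x$2)\<^sup>2"
        by (simp add: power2_eq_square algebra_simps)
      also have "\<dots> = (a * x$1 + b * x$2)\<^sup>2"
        unfolding ad(3) by (simp add: power2_eq_square algebra_simps)
      finally have "0 \<le> a * (a * (x$1)\<^sup>2 + 2 * b * x$1 * x$2 + d * (x$2)\<^sup>2)"
        by simp
      then show ?thesis
        using False ad(1) eq by (simp add: zero_le_mult_iff)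
    qed
  qed
  ultimately show "?B \<in> psd_mats_rank_le 1 UNIV"
    by (simp add: psd_mats_rank_le_def psd_mats_def sym_mats_def)
qed

end

theory Submission
  imports Defs
begin

text \<open>
  Write \<open>p\<close> for the Taylor polynomial of \<open>f\<close> at \<open>0\<close>, cut off at its \<open>k\<close>-th nonzero term
  (the \<open>(n - 1)\<close>-st one for the statement on positive Taylor coefficients), so that
  \<open>f x = p x + o(x^N)\<close> with \<open>N = degree p\<close>. On a rank-one matrix \<open>u u^T\<close> each monomial
  \<open>c x^m\<close> of \<open>p\<close> contributes \<open>c\<close> times the rank-one matrix of the vector of entrywise powers
  \<open>u^m\<close>. This gives the sufficiency statements at once. It also shows how to go back: if \<open>k\<close>
  coordinates of \<open>u\<close> are \<open>t v\<^sub>j\<close> with a small \<open>t\<close>, then a generalized Vandermonde matrix provides test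
  vectors dual to the power vectors, of size \<open>t^(- m)\<close>, and each remaining coordinate \<open>w\<close> gives a
  test vector that the power functionals annihilate. In this basis the Gram matrix of \<open>f[u u^T]\<close>
  converges, as \<open>t\<close> tends to \<open>0\<close>, to the block-diagonal matrix with the Taylor coefficients on one
  block and the values \<open>(f - p)(w w')\<close> on the other (\<open>gram_limit\<close>).

  Everything on \<open>[0, R)\<close> follows from this limit. If \<open>f[-]\<close> preserves positivity, the limit is
  positive semidefinite, so the Taylor coefficients and \<open>f(w^2) - p(w^2)\<close> are nonnegative. If
  \<open>f[-]\<close> has rank at most \<open>k\<close>, the limit with one far coordinate is a singular matrix of size \<open>k + 1\<close>,
  and \<open>f(w^2) = p(w^2)\<close>.

  At a negative point \<open>- y\<close> put \<open>\<delta> = f(- y) - p(- y)\<close>. For \<open>k = 1\<close> a \<open>2 \<times> 2\<close> minor in three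
  coordinates gives \<open>\<delta> = 0\<close>. For \<open>k \<ge> 2\<close>, use the limit for the polynomial \<open>p\<close> without its leading
  term and the two far coordinates \<open>sqrt y\<close> and \<open>- sqrt y\<close>: the absolute values of \<open>f(- y) - p(- y) + c (- y)^N\<close> and
  \<open>c y^N\<close> agree, where \<open>c\<close> is the leading coefficient. Since \<open>\<delta> = o(y^N)\<close>, this
  forces \<open>f = p\<close> close to \<open>0\<close>. For an arbitrary \<open>y\<close> choose \<open>k - 1\<close> coordinates so small
  that \<open>- y\<close> is the only argument at which \<open>f\<close> and \<open>p\<close> may differ, and the last two coordinates
  \<open>w\<close> and \<open>- y / w\<close>. If \<open>\<delta>\<close> is not zero, singularity of the matrix becomes an exact identity \<open>\<delta> D = - 2 A(w) A(- y / w)\<close>,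
  in which \<open>D\<close> does not depend on \<open>w\<close> and \<open>A\<close> is a polynomial vanishing at the small coordinates
  (\<open>sign_defect_identity\<close>). Multiplied by \<open>w^N\<close> it is a polynomial identity in \<open>w\<close>; evaluating it at a zero of \<open>A\<close>
  gives \<open>\<delta> D = 0\<close>. Then \<open>A(w) A(- y / w) = 0\<close> for infinitely many \<open>w\<close>, which is impossible for a
  polynomial \<open>A\<close> with leading coefficient \<open>1\<close>; so \<open>\<delta> = 0\<close> from the start.
\<close>

section \<open>Taylor expansion with Peano remainder\<close>

text \<open>
  \<open>g = o(x^N)\<close> at \<open>0\<close> within \<open>S\<close>. For \<open>N = 0\<close> only the value at \<open>0\<close> is constrained: having a
  derivative of order zero does not make a function continuous.
\<close>
definition peano_small :: "nat \<Rightarrow> real set \<Rightarrow> (real \<Rightarrow> real) \<Rightarrow> bool" where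
  "peano_small N S g \<longleftrightarrow>
     g 0 = 0 \<and> (0 < N \<longrightarrow> ((\<lambda>x. g x / x ^ N) \<longlongrightarrow> 0) (at 0 within S))"

text \<open>
  Arbitrary where \<open>f\<close> has no derivative.
\<close>
definition derivative_within :: "(real \<Rightarrow> real) \<Rightarrow> real set \<Rightarrow> real \<Rightarrow> real" where
  "derivative_within f S x = (SOME D. has_nth_derivative 1 f S x D)"

lemma has_nth_derivative_1_imp:
  assumes "has_nth_derivative 1 f S x D" and "x \<in> S"
  shows "(f has_real_derivative D) (at x within S)"
proof -
  obtain g where g: "\<forall>\<^sub>F y in nhds x. y \<in> S \<longrightarrow> f y = g y" "(g has_real_derivative D) (at x within S)"
    using assms(1) by auto
  have "f x = g x"
    using eventually_nhds_x_imp_x[OF g(1)] assms(2) by blast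
  moreover have "\<forall>\<^sub>F y in at x within S. f y = g y"
    using g(1) unfolding eventually_at_filter by eventually_elim auto
  ultimately show ?thesis
    using g(2) has_field_derivative_cong_eventually by blast
qed

lemma has_nth_derivative_lower:
  assumes "has_nth_derivative m f S x D" and "x \<in> S" and "j \<le> m"
  shows "\<exists>E. has_nth_derivative j f S x E"
  using assms
proof (induction m arbitrary: D)
  case 0
  then show ?case by auto
next
  case (Suc m)
  show ?case
  proof (cases "j = Suc m")
    case True
    then show ?thesis using Suc.prems by blast
  next
    case False
    obtain g where "\<forall>\<^sub>F y in nhds x. y \<in> S \<longrightarrow> has_nth_derivative m f S y (g y)"
      using Suc.prems(1) by auto
    then have "has_nth_derivative m f S x (g x)"
      using eventually_nhds_x_imp_x Suc.prems(2) by blast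
    then show ?thesis
      using Suc False by simp
  qed
qed

text \<open>
  The recursion defining higher derivatives splits off the last differentiation; an induction for
  Taylor's theorem has to split off the first one.
\<close>
lemma has_nth_derivative_shift:
  assumes "\<And>y. y \<in> S \<Longrightarrow> at y within S \<noteq> bot"
    and "has_nth_derivative (Suc m) f S x D" and "x \<in> S"
  shows "has_nth_derivative m (derivative_within f S) S x D"
  using assms(2-)
proof (induction m arbitrary: x D)
  case 0
  then have D: "has_nth_derivative 1 f S x D" by simp
  then have "has_nth_derivative 1 f S x (derivative_within f S x)"
    unfolding derivative_within_def by (rule someI)
  then have "derivative_within f S x = D"
    using has_nth_derivative_unique[OF assms(1) 0(2)] D by blast
  then show ?case by simp
next
  case (Suc m)
  obtain g where "\<forall>\<^sub>F y in nhds x. y \<in> S \<longrightarrow> has_nth_derivative (Suc m) f S y (g y)"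
    and g: "(g has_real_derivative D) (at x within S)"
    using Suc.prems(1) by (metis has_nth_derivative.simps(2))
  then have "\<forall>\<^sub>F y in nhds x. y \<in> S \<longrightarrow> has_nth_derivative m (derivative_within f S) S y (g y)"
    using Suc.IH by (auto elim!: eventually_mono)
  then show ?case
    using g by auto
qed

text \<open>
  Two derivatives at \<open>x\<close> are needed for one derivative on a whole neighbourhood of \<open>x\<close>, which is
  what the mean value theorem asks for.
\<close>
lemma eventually_derivative_within:
  assumes "has_nth_derivative (Suc (Suc m)) f S x D" and "x \<in> S"
  shows "\<forall>\<^sub>F y in nhds x. y \<in> S \<longrightarrow>
           (f has_real_derivative derivative_within f S y) (at y within S)"
proof -
  obtain g where "\<forall>\<^sub>F y in nhds x. y \<in> S \<longrightarrow> has_nth_derivative (Suc m) f S y (g y)"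
    using assms(1) by (metis has_nth_derivative.simps(2))
  then show ?thesis
  proof eventually_elim
    case (elim y)
    show ?case
    proof
      assume y: "y \<in> S"
      then obtain E where "has_nth_derivative 1 f S y E"
        using has_nth_derivative_lower[OF elim[rule_format, OF y] y, of 1] by auto
      then have "has_nth_derivative 1 f S y (derivative_within f S y)"
        unfolding derivative_within_def by (rule someI)
      then show "(f has_real_derivative derivative_within f S y) (at y within S)"
        using has_nth_derivative_1_imp y by blast
    qed
  qed
qed

text \<open>
  If \<open>\<bar>g' y\<bar> \<le> e \<bar>y\<bar>^N\<close> on the segment from \<open>0\<close> to \<open>x\<close>, the mean value theorem gives
  \<open>\<bar>g x\<bar> \<le> e \<bar>x\<bar>^(N + 1)\<close>.
\<close>
lemma peano_small_antiderivative:
  fixes g :: "real \<Rightarrow> real"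
  assumes "convex S" and "0 \<in> S" and "0 < N" and "g 0 = 0" and small: "peano_small N S g'"
    and deriv: "\<forall>\<^sub>F y in nhds 0. y \<in> S \<longrightarrow> (g has_real_derivative g' y) (at y within S)"
  shows "peano_small (Suc N) S g"
proof -
  have lim: "((\<lambda>x. g' x / x ^ N) \<longlongrightarrow> 0) (at 0 within S)" and g'0: "g' 0 = 0"
    using small \<open>0 < N\<close> by (auto simp: peano_small_def)
  have "((\<lambda>x. g x / x ^ Suc N) \<longlongrightarrow> 0) (at 0 within S)"
  proof (rule tendstoI)
    fix e :: real assume "0 < e"
    then have "\<forall>\<^sub>F x in at 0 within S. dist (g' x / x ^ N) 0 < e / 2"
      using lim by (intro tendstoD) auto
    then have "\<forall>\<^sub>F x in nhds 0. x \<noteq> 0 \<longrightarrow> x \<in> S \<longrightarrow> \<bar>g' x / x ^ N\<bar> < e / 2"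
      by (simp add: eventually_at_filter dist_real_def)
    from eventually_conj[OF this deriv] obtain d where "0 < d"
      and d1: "\<And>x. \<bar>x\<bar> < d \<Longrightarrow> x \<noteq> 0 \<Longrightarrow> x \<in> S \<Longrightarrow> \<bar>g' x / x ^ N\<bar> < e / 2"
      and d2: "\<And>x. \<bar>x\<bar> < d \<Longrightarrow> x \<in> S \<Longrightarrow> (g has_real_derivative g' x) (at x within S)"
      unfolding eventually_nhds_metric dist_real_def by auto
    have "dist (g x / x ^ Suc N) 0 < e" if x: "x \<in> S" "x \<noteq> 0" "\<bar>x\<bar> < d" for x
    proof -
      let ?T = "closed_segment 0 x"
      have T: "?T \<subseteq> S"
        using \<open>convex S\<close> \<open>0 \<in> S\<close> x(1) by (simp add: closed_segment_subset)
      have Tle: "\<bar>y\<bar> \<le> \<bar>x\<bar>" if "y \<in> ?T" for y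
        using that by (auto simp: closed_segment_eq_real_ivl split: if_splits)
      have "norm (g x - g 0) \<le> (e / 2 * \<bar>x\<bar> ^ N) * norm (x - 0)"
      proof (rule field_differentiable_bound)
        show "convex ?T" by simp
        fix y assume y: "y \<in> ?T"
        then have yd: "\<bar>y\<bar> < d" "y \<in> S" using Tle[of y] x(3) T by auto
        show "(g has_field_derivative g' y) (at y within ?T)"
          using d2[OF yd] T DERIV_subset by blast
        show "norm (g' y) \<le> e / 2 * \<bar>x\<bar> ^ N"
        proof (cases "y = 0")
          case True
          then show ?thesis using g'0 \<open>0 < e\<close> by simp
        next
          case False
          then have "\<bar>g' y\<bar> \<le> e / 2 * \<bar>y\<bar> ^ N"
            using d1[OF yd(1) False yd(2)] by (simp add: power_abs field_simps)
          also have "\<dots> \<le> e / 2 * \<bar>x\<bar> ^ N"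
            using Tle[OF y] \<open>0 < e\<close> by (intro mult_left_mono power_mono) auto
          finally show ?thesis by simp
        qed
      qed auto
      then have "\<bar>g x\<bar> \<le> e / 2 * \<bar>x\<bar> ^ Suc N"
        using \<open>g 0 = 0\<close> by (simp add: algebra_simps)
      then have "\<bar>g x / x ^ Suc N\<bar> \<le> e / 2"
        using x(2) by (simp add: power_abs field_simps del: power_Suc)
      also have "\<dots> < e" using \<open>0 < e\<close> by simp
      finally show ?thesis by (simp only: dist_real_def diff_zero)
    qed
    then show "\<forall>\<^sub>F x in at 0 within S. dist (g x / x ^ Suc N) 0 < e"
      unfolding eventually_at using \<open>0 < d\<close> by (auto simp: dist_real_def)
  qed
  then show ?thesis
    using \<open>g 0 = 0\<close> by (simp add: peano_small_def)
qed

text \<open>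
  Induction on the order: the derivative of the remainder of \<open>f\<close> is the remainder of \<open>f'\<close> of one
  order less. Order one is the definition of the derivative, because then \<open>f\<close> need not be
  differentiable anywhere except at \<open>0\<close>.
\<close>
theorem peano_taylor:
  fixes S :: "real set"
  assumes "convex S" and "0 \<in> S" and nb: "\<And>y. y \<in> S \<Longrightarrow> at y within S \<noteq> bot"
    and "\<forall>j\<le>N. has_nth_derivative j f S 0 (a j)"
  shows "peano_small N S (\<lambda>x. f x - (\<Sum>j\<le>N. a j / fact j * x ^ j))"
  using assms(4)
proof (induction N arbitrary: f a)
  case 0
  then show ?case by (simp add: peano_small_def)
next
  case (Suc N)
  have f0: "f 0 = a 0" using Suc.prems[rule_format, of 0] by simp
  have vanish: "(\<Sum>j\<le>M. a j / fact j * 0 ^ j) = a 0" for M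
    by (subst sum.atMost_shift) simp
  show ?case
  proof (cases N)
    case 0
    have "has_nth_derivative 1 f S 0 (a 1)"
      using Suc.prems[rule_format, of 1] by simp
    then have "(f has_real_derivative a 1) (at 0 within S)"
      using has_nth_derivative_1_imp \<open>0 \<in> S\<close> by blast
    then have "((\<lambda>x. (f x - f 0) / x - a 1) \<longlongrightarrow> 0) (at 0 within S)"
      by (subst LIM_zero_iff) (simp add: has_field_derivative_iff)
    then have "((\<lambda>x. (f x - (a 0 + a 1 * x)) / x) \<longlongrightarrow> 0) (at 0 within S)"
      by (rule tendsto_cong[THEN iffD1, rotated])
         (auto simp: eventually_at_filter f0 field_simps)
    then show ?thesis
      using f0 by (simp add: 0 peano_small_def)
  next
    case (Suc N')
    let ?f' = "derivative_within f S"
    have "\<forall>j\<le>N. has_nth_derivative j ?f' S 0 (a (Suc j))"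
      using has_nth_derivative_shift[OF nb _ \<open>0 \<in> S\<close>] Suc.prems by (metis Suc_le_mono)
    from Suc.IH[OF this]
    have IH: "peano_small N S (\<lambda>x. ?f' x - (\<Sum>j\<le>N. a (Suc j) / fact j * x ^ j))" .
    show ?thesis
    proof (rule peano_small_antiderivative[OF \<open>convex S\<close> \<open>0 \<in> S\<close> _ _ IH])
      show "0 < N" using Suc by simp
      show "f 0 - (\<Sum>j\<le>Suc N. a j / fact j * 0 ^ j) = 0"
        by (simp only: vanish f0 diff_self)
      have "has_nth_derivative (Suc (Suc N')) f S 0 (a (Suc N))"
        using Suc.prems Suc by blast
      from eventually_derivative_within[OF this \<open>0 \<in> S\<close>]
      show "\<forall>\<^sub>F y in nhds 0. y \<in> S \<longrightarrow>
          ((\<lambda>x. f x - (\<Sum>j\<le>Suc N. a j / fact j * x ^ j)) has_real_derivative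
           ?f' y - (\<Sum>j\<le>N. a (Suc j) / fact j * y ^ j)) (at y within S)"
      proof eventually_elim
        case (elim y)
        have "((\<lambda>x. \<Sum>j\<le>Suc N. a j / fact j * x ^ j) has_real_derivative
               (\<Sum>j\<le>Suc N. a j / fact j * (real j * y ^ (j - 1)))) (at y within S)"
          by (rule DERIV_sum) (auto intro!: derivative_eq_intros)
        also have "(\<Sum>j\<le>Suc N. a j / fact j * (real j * y ^ (j - 1)))
                 = (\<Sum>j\<le>N. a (Suc j) / fact (Suc j) * (real (Suc j) * y ^ j))"
          by (subst sum.atMost_Suc_shift) simp
        also have "\<dots> = (\<Sum>j\<le>N. a (Suc j) / fact j * y ^ j)"
          by (intro sum.cong refl) (simp add: field_simps del: of_nat_Suc)
        finally show ?case
          using elim DERIV_diff by blast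
      qed
    qed
  qed
qed

section \<open>Rank, kernels and rank-one matrices\<close>

lemma finite_coeff_support: "finite {i. coeff p i \<noteq> 0}"
  by (simp add: MOST_coeff_eq_0 flip: eventually_cofinite) 

lemma poly_eq_sum_support:
  fixes p :: "real poly"
  shows "poly p x = (\<Sum>i | coeff p i \<noteq> 0. coeff p i * x ^ i)"
proof -
  have "poly p x = (\<Sum>i\<le>degree p. coeff p i * x ^ i)" by (rule poly_altdef)
  also have "... = (\<Sum>i | coeff p i \<noteq> 0. coeff p i * x ^ i)"
    by (rule sum.mono_neutral_right) (auto simp: le_degree)
  finally show ?thesis .
qed

text \<open>
  A subspace of dimension larger than the rank meets the kernel nontrivially; here it is the coordinate subspace
  of \<open>P\<close>.
\<close>
lemma matrix_kernel_on_indices: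
  fixes A :: "real^'n^'n"
  assumes "rank A < card P"
  shows "\<exists>y. y \<noteq> 0 \<and> (\<forall>i. i \<notin> P \<longrightarrow> y $ i = 0) \<and> A *v y = 0"
proof (rule ccontr)
  assume no: "\<not> ?thesis"
  let ?S = "{x::real^'n. \<forall>i. i \<notin> P \<longrightarrow> x $ i = 0}"
  have sub: "subspace ?S" by (auto simp: subspace_def)
  have "inj_on ((*v) A) (span ?S)"
  proof (rule inj_onI)
    fix x y assume "x \<in> span ?S" "y \<in> span ?S" "A *v x = A *v y"
    then have "x - y \<in> ?S" "A *v (x - y) = 0"
      using sub by (auto simp: span_eq_iff[THEN iffD2] matrix_vector_mult_diff_distrib)
    then have "x - y = 0" using no by blast
    then show "x = y" by simp
  qed
  then have "dim ((*v) A ` ?S) = dim ?S"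
    by (intro dim_image_eq) auto
  moreover have "dim ?S = card P"
    using dim_substandard_cart[where 'a = real, of P] by (simp add: dim_vec_eq)
  moreover have "dim ((*v) A ` ?S) \<le> rank A"
    unfolding rank_dim_range by (intro dim_subset) auto
  ultimately show False using assms by simp
qed

lemma rank_le_one_minor:
  fixes A :: "real^'n^'n"
  assumes "rank A \<le> 1"
  shows "A $ i $ j * A $ k $ l = A $ i $ l * A $ k $ j"
proof (cases "j = l")
  case False
  then obtain y where y: "y \<noteq> 0" "\<And>i. i \<notin> {j, l} \<Longrightarrow> y $ i = 0" "A *v y = 0"
    using matrix_kernel_on_indices[of A "{j, l}"] assms by auto
  have eq: "A $ a $ j * y $ j + A $ a $ l * y $ l = 0" for a
  proof -
    have "0 = (\<Sum>b\<in>UNIV. A $ a $ b * y $ b)"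
      using arg_cong[OF y(3), of "\<lambda>x. x $ a"] by (simp add: matrix_vector_mult_def)
    also have "\<dots> = (\<Sum>b\<in>{j, l}. A $ a $ b * y $ b)"
      by (rule sum.mono_neutral_right) (use y(2) in auto)
    finally show ?thesis using False by simp
  qed
  have "y $ j \<noteq> 0 \<or> y $ l \<noteq> 0"
  proof (rule ccontr)
    assume "\<not> ?thesis"
    then have "y $ i = 0" for i using y(2)[of i] by (cases "i \<in> {j, l}") auto
    then show False using y(1) by (simp add: vec_eq_iff)
  qed
  then show ?thesis
  proof
    assume "y $ j \<noteq> 0"
    moreover have "(A $ i $ j * A $ k $ l - A $ i $ l * A $ k $ j) * y $ j
        = A $ k $ l * (A $ i $ j * y $ j + A $ i $ l * y $ l)
          - A $ i $ l * (A $ k $ j * y $ j + A $ k $ l * y $ l)"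
      by (simp add: algebra_simps)
    ultimately show ?thesis unfolding eq by simp
  next
    assume "y $ l \<noteq> 0"
    moreover have "(A $ i $ j * A $ k $ l - A $ i $ l * A $ k $ j) * y $ l
        = A $ i $ j * (A $ k $ j * y $ j + A $ k $ l * y $ l)
          - A $ k $ j * (A $ i $ j * y $ j + A $ i $ l * y $ l)"
      by (simp add: algebra_simps)
    ultimately show ?thesis unfolding eq by simp
  qed
qed simp

definition outer :: "real^'n \<Rightarrow> real^'n^'n" where
  "outer u = (\<chi> i j. u $ i * u $ j)"

text \<open>
  These linear functionals diagonalize the bilinear forms \<open>p[u u^T]\<close> for all polynomials \<open>p\<close>.
\<close>
definition power_functional :: "real^'n \<Rightarrow> nat \<Rightarrow> real^'n \<Rightarrow> real" where
  "power_functional u m x = (\<Sum>a\<in>UNIV. x $ a * u $ a ^ m)"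

text \<open>
  By the \<open>2 \<times> 2\<close> minors, a nonzero diagonal entry \<open>A $ a $ a\<close> determines \<open>A\<close> from its \<open>a\<close>-th column;
  if the diagonal is zero, so is \<open>A\<close>. Semidefiniteness makes the square root available.
\<close>
lemma psd_rank_one_is_outer:
  fixes A :: "real^'n^'n"
  assumes "A \<in> psd_mats_rank_le 1 J"
  obtains u where "A = outer u"
proof -
  have tr: "transpose A = A" and psd: "\<And>x. 0 \<le> x \<bullet> (A *v x)" and rk: "rank A \<le> 1"
    using assms by (auto simp: psd_mats_rank_le_def psd_mats_def sym_mats_def)
  have sym: "A $ i $ j = A $ j $ i" for i j
    using arg_cong[OF tr, of "\<lambda>M. M $ i $ j"] by (simp add: transpose_def)
  have diag: "0 \<le> A $ i $ i" for i
    using psd[of "axis i 1"] by (simp add: inner_axis' matrix_vector_mul_component inner_axis)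
  note minor = rank_le_one_minor[OF rk]
  show ?thesis
  proof (cases "\<exists>a. A $ a $ a \<noteq> 0")
    case True
    then obtain a where "A $ a $ a \<noteq> 0" by blast
    then have a: "A $ a $ a > 0" using diag[of a] by (simp add: less_le)
    have "A = outer (\<chi> i. A $ i $ a / sqrt (A $ a $ a))"
    proof -
      have "A $ i $ j = (A $ i $ a / sqrt (A $ a $ a)) * (A $ j $ a / sqrt (A $ a $ a))" for i j
      proof -
        have "A $ i $ j * A $ a $ a = A $ i $ a * A $ j $ a"
          using minor[of i j a a] sym[of a j] by simp
        then have "A $ i $ j = A $ i $ a * A $ j $ a / A $ a $ a"
          using a by (simp add: eq_divide_eq)
        then show ?thesis using a by (simp add: times_divide_times_eq)
      qed
      then show ?thesis unfolding outer_def vec_eq_iff vec_lambda_beta by blast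
    qed
    then show ?thesis using that by blast
  next
    case False
    have "A $ i $ j = 0" for i j
      using minor[of i j j i] sym[of j i] False by auto
    then have "A = outer 0" by (simp add: outer_def vec_eq_iff)
    then show ?thesis using that by blast
  qed
qed

lemma outer_in_psd_rank_one:
  fixes u :: "real^'n"
  assumes "\<And>i j. u $ i * u $ j \<in> J"
  shows "outer u \<in> psd_mats_rank_le 1 J"
proof -
  have mult: "outer u *v x = (u \<bullet> x) *\<^sub>R u" for x
  proof -
    have "(outer u *v x) $ i = u $ i * (u \<bullet> x)" for i
      by (simp add: outer_def matrix_vector_mult_def inner_vec_def sum_distrib_left mult.assoc)
    then show ?thesis by (simp add: vec_eq_iff mult.commute)
  qed
  have "outer u *v x \<in> span {u}" for x
    unfolding mult by (rule span_mul, rule span_base) simp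
  then have "range ((*v) (outer u)) \<subseteq> span {u}"
    by blast
  then have "dim (range ((*v) (outer u))) \<le> card {u}"
    by (intro dim_le_card) auto
  then have "rank (outer u) \<le> 1"
    by (simp add: rank_dim_range)
  moreover have "transpose (outer u) = outer u"
    by (simp add: outer_def transpose_def vec_eq_iff mult.commute)
  moreover have "0 \<le> x \<bullet> (outer u *v x)" for x
    by (simp add: mult inner_commute)
  moreover have "outer u $ i $ j \<in> J" for i j
    using assms by (simp add: outer_def)
  ultimately show ?thesis
    by (simp add: psd_mats_rank_le_def psd_mats_def sym_mats_def)
qed

text \<open>
  This is \<open>(u\<^sub>a u\<^sub>b)^i = u\<^sub>a^i u\<^sub>b^i\<close>. Agreement of \<open>f\<close> with \<open>p\<close> is asked for at the products of
  coordinates only, because \<open>f\<close> is a polynomial on an interval at best.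
\<close>
lemma entrywise_poly_outer_mult:
  fixes u x :: "real^'n"
  assumes f: "\<And>i j. f (u $ i * u $ j) = poly p (u $ i * u $ j)"
  shows "entrywise f (outer u) *v x =
    (\<Sum>m | coeff p m \<noteq> 0. (coeff p m * power_functional u m x) *\<^sub>R (\<chi> a. u $ a ^ m))"
proof (rule vec_eq_iff[THEN iffD2], rule allI)
  fix a
  have "(entrywise f (outer u) *v x) $ a =
      (\<Sum>b\<in>UNIV. \<Sum>m | coeff p m \<noteq> 0. coeff p m * (u $ a * u $ b) ^ m * x $ b)"
    by (simp add: matrix_vector_mult_def entrywise_def outer_def f poly_eq_sum_support
        sum_distrib_right)
  also have "\<dots> = (\<Sum>m | coeff p m \<noteq> 0. coeff p m * power_functional u m x * u $ a ^ m)"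
    by (subst sum.swap)
       (simp add: power_functional_def sum_distrib_left sum_distrib_right power_mult_distrib ac_simps)
  finally show "(entrywise f (outer u) *v x) $ a =
    (\<Sum>m | coeff p m \<noteq> 0. (coeff p m * power_functional u m x) *\<^sub>R (\<chi> a. u $ a ^ m)) $ a"
    by simp
qed

lemma entrywise_poly_outer_form:
  fixes u x y :: "real^'n"
  assumes "\<And>i j. f (u $ i * u $ j) = poly p (u $ i * u $ j)"
  shows "x \<bullet> (entrywise f (outer u) *v y) =
    (\<Sum>m | coeff p m \<noteq> 0. coeff p m * power_functional u m x * power_functional u m y)"
proof -
  have *: "x \<bullet> (\<chi> a. u $ a ^ m) = power_functional u m x" for m
    by (simp add: power_functional_def inner_vec_def)
  show ?thesis
    unfolding entrywise_poly_outer_mult[where f = f, OF assms] inner_sum_right inner_scaleR_right *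
    by (simp add: ac_simps)
qed

lemma entrywise_poly_outer_rank:
  fixes u :: "real^'n"
  assumes "\<And>i j. f (u $ i * u $ j) = poly p (u $ i * u $ j)"
  shows "rank (entrywise f (outer u)) \<le> card {m. coeff p m \<noteq> 0}"
proof -
  let ?M = "{m. coeff p m \<noteq> 0}"
  let ?v = "\<lambda>m. (\<chi> a. u $ a ^ m) :: real^'n"
  have "entrywise f (outer u) *v x \<in> span (?v ` ?M)" for x
    unfolding entrywise_poly_outer_mult[where f = f, OF assms]
    by (rule span_sum, rule span_mul, rule span_base) simp
  then have "range ((*v) (entrywise f (outer u))) \<subseteq> span (?v ` ?M)"
    by blast
  then have "rank (entrywise f (outer u)) \<le> card (?v ` ?M)"
    unfolding rank_dim_range by (intro dim_le_card) (auto simp: finite_coeff_support)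
  also have "\<dots> \<le> card ?M" by (rule card_image_le[OF finite_coeff_support])
  finally show ?thesis .
qed

lemma transpose_entrywise_outer: "transpose (entrywise f (outer u)) = entrywise f (outer u)"
  by (simp add: entrywise_def outer_def transpose_def vec_eq_iff mult.commute)

section \<open>Generalized Vandermonde matrices and singular limits\<close>

text \<open>
  For arbitrary distinct exponents some positive nodes give an invertible matrix of powers
  \<open>v j ^ m i\<close>. With the nodes \<open>2^0, 2^1, \<dots>\<close> the roles can be exchanged: \<open>(2^j)^(m i) = (2^(m i))^j\<close>
  is an ordinary Vandermonde matrix with the distinct nodes \<open>2^(m i)\<close>, so a kernel vector is a
  polynomial with too many roots.
\<close>
lemma generalized_vandermonde_inverse:
  fixes m :: "'n::finite \<Rightarrow> nat"
  assumes "inj_on m J"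
  shows "\<exists>(v :: 'n \<Rightarrow> real) (\<alpha> :: 'n \<Rightarrow> 'n \<Rightarrow> real). (\<forall>j. 0 < v j) \<and>
    (\<forall>i\<in>J. \<forall>l\<in>J. (\<Sum>j\<in>J. \<alpha> i j * v j ^ m l) = (if i = l then 1 else 0)) \<and>
    (\<forall>j\<in>J. \<forall>l\<in>J. (\<Sum>i\<in>J. v j ^ m i * \<alpha> i l) = (if j = l then 1 else 0))"
proof -
  obtain \<iota> where \<iota>: "bij_betw \<iota> J {0..<card J}"
    using ex_bij_betw_finite_nat[of J] by auto
  define v :: "'n \<Rightarrow> real" where "v j = 2 ^ \<iota> j" for j
  have ker: "z j = 0"
    if z: "\<And>i. i \<in> J \<Longrightarrow> (\<Sum>j\<in>J. z j * v j ^ m i) = 0" and j: "j \<in> J" for z j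
  proof -
    define q :: "real poly" where "q = (\<Sum>j\<in>J. monom (z j) (\<iota> j))"
    have root: "poly q (2 ^ m i) = 0" if "i \<in> J" for i
      using z[OF that]
      by (simp add: q_def poly_sum poly_monom v_def mult.commute flip: power_mult)
    have "q = 0"
    proof (rule ccontr)
      assume "q \<noteq> 0"
      have deg: "degree q < card J"
      proof -
        have "degree q \<le> card J - 1"
          unfolding q_def
        proof (rule degree_sum_le)
          fix j assume "j \<in> J"
          then have "\<iota> j < card J" using \<iota> by (auto simp: bij_betw_def)
          then show "degree (monom (z j) (\<iota> j)) \<le> card J - 1"
            using degree_monom_le[of "z j" "\<iota> j"] by simp
        qed simp
        moreover have "0 < card J" using j by (auto simp: card_gt_0_iff)
        ultimately show ?thesis by simp
      qed
      have "inj_on (\<lambda>i. 2 ^ m i :: real) J"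
        using assms by (auto simp: inj_on_def)
      then have "card J = card ((\<lambda>i. 2 ^ m i :: real) ` J)"
        by (simp add: card_image)
      also have "\<dots> \<le> card {x. poly q x = 0}"
        using root \<open>q \<noteq> 0\<close> by (intro card_mono poly_roots_finite) auto
      finally have "card J \<le> card {x. poly q x = 0}" .
      then show False
        using deg card_poly_roots_bound[OF \<open>q \<noteq> 0\<close>] by simp
    qed
    then have "0 = coeff q (\<iota> j)" by simp
    also have "\<dots> = (\<Sum>i\<in>J. if i = j then z j else 0)"
      unfolding q_def coeff_sum
      by (intro sum.cong) (use \<iota> j in \<open>auto simp: bij_betw_def inj_on_def\<close>)
    also have "\<dots> = z j" using j by simp
    finally show ?thesis by simp
  qed
  define W :: "real^'n^'n" where
    "W = (\<chi> i j. if i \<in> J \<and> j \<in> J then v j ^ m i else if i = j then 1 else 0)"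
  have W_sum: "(\<Sum>j\<in>UNIV. W $ i $ j * x j) = (\<Sum>j\<in>J. v j ^ m i * x j)" if "i \<in> J" for i x
    using that by (intro sum.mono_neutral_cong_right) (auto simp: W_def)
  have W_sum': "(\<Sum>j\<in>UNIV. W $ i $ j * x j) = x i" if "i \<notin> J" for i x
  proof -
    have "(\<Sum>j\<in>UNIV. W $ i $ j * x j) = (\<Sum>j\<in>UNIV. if j = i then x j else 0)"
      using that by (intro sum.cong) (auto simp: W_def)
    then show ?thesis by simp
  qed
  have "x = 0" if "W *v x = 0" for x
  proof -
    have *: "(\<Sum>j\<in>UNIV. W $ i $ j * x $ j) = 0" for i
      using arg_cong[OF that, of "\<lambda>y. y $ i"] by (simp add: matrix_vector_mult_def)
    have "x $ i = 0" for i
    proof (cases "i \<in> J")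
      case True
      have "(\<Sum>j\<in>J. x $ j * v j ^ m l) = 0" if "l \<in> J" for l
        using *[of l] unfolding W_sum[OF that] by (simp add: mult.commute)
      then show ?thesis
        using ker[OF _ True] by blast
    next
      case False
      show ?thesis using *[of i] unfolding W_sum'[OF False] .
    qed
    then show ?thesis by (simp add: vec_eq_iff)
  qed
  then obtain V where VW: "V ** W = mat 1"
    using matrix_left_invertible_ker by blast
  then have WV: "W ** V = mat 1"
    by (simp add: matrix_left_right_inverse)
  show ?thesis
  proof (intro exI conjI ballI allI)
    show "0 < v j" for j by (simp add: v_def)
  next
    fix i l assume il: "i \<in> J" "l \<in> J"
    have "(W ** V) $ l $ i = (\<Sum>j\<in>J. v j ^ m l * V $ j $ i)"
      using W_sum[OF il(2)] by (simp add: matrix_matrix_mult_def)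
    then show "(\<Sum>j\<in>J. V $ j $ i * v j ^ m l) = (if i = l then 1 else 0)"
      by (auto simp: WV mat_def mult.commute)
  next
    fix i l assume il: "i \<in> J" "l \<in> J"
    have "(V ** W) $ l $ i = (\<Sum>j\<in>UNIV. V $ l $ j * W $ j $ i)"
      by (simp add: matrix_matrix_mult_def)
    also have "\<dots> = (\<Sum>j\<in>J. V $ l $ j * v i ^ m j)"
      using il by (intro sum.mono_neutral_cong_right) (auto simp: W_def)
    finally show "(\<Sum>j\<in>J. v i ^ m j * V $ l $ j) = (if i = l then 1 else 0)"
      by (auto simp: VW mat_def mult.commute)
  qed
qed

text \<open>
  As many vectors as the rank plus one have linearly dependent images, where a dependence between
  equal vectors counts as well.
\<close>
lemma kernel_of_frame:
  fixes A :: "real^'n^'n" and X :: "'n \<Rightarrow> real^'n"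
  assumes "rank A < card P"
  shows "\<exists>y. y \<noteq> 0 \<and> (\<forall>i. i \<notin> P \<longrightarrow> y $ i = 0) \<and> A *v (\<Sum>q\<in>P. y $ q *\<^sub>R X q) = 0"
proof -
  define M :: "real^'n^'n" where "M = (\<chi> a q. X q $ a)"
  have "rank (A ** M) < card P"
    using rank_mul_le_left[of A M] assms by linarith
  then obtain y where y: "y \<noteq> 0" "\<And>i. i \<notin> P \<Longrightarrow> y $ i = 0" "(A ** M) *v y = 0"
    using matrix_kernel_on_indices by blast
  have "M *v y = (\<Sum>q\<in>UNIV. y $ q *\<^sub>R X q)"
    by (simp add: vec_eq_iff M_def matrix_vector_mult_def mult.commute)
  also have "\<dots> = (\<Sum>q\<in>P. y $ q *\<^sub>R X q)"
    using y(2) by (intro sum.mono_neutral_right) auto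
  finally show ?thesis
    using y by (auto simp: matrix_vector_mul_assoc[symmetric])
qed

text \<open>
  The block of \<open>G\<close> on the indices \<open>P\<close>, completed by the identity, so that the determinant of a
  block of any size is that of a matrix on the full index type.
\<close>
definition padded :: "'n set \<Rightarrow> ('n \<Rightarrow> 'n \<Rightarrow> real) \<Rightarrow> real^'n^'n" where
  "padded P G = (\<chi> p q. if p \<in> P \<and> q \<in> P then G p q else if p = q then 1 else 0)"

lemma det_padded_eq_0_iff:
  fixes G :: "'n::finite \<Rightarrow> 'n \<Rightarrow> real"
  shows "det (padded P G) = 0 \<longleftrightarrow>
    (\<exists>y::real^'n. y \<noteq> 0 \<and> (\<forall>i. i \<notin> P \<longrightarrow> y $ i = 0) \<and> (\<forall>p\<in>P. (\<Sum>q\<in>P. G p q * y $ q) = 0))"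
    (is "_ = (\<exists>y. ?K y)")
proof -
  have in_P: "(padded P G *v y) $ p = (\<Sum>q\<in>P. G p q * y $ q)" if "p \<in> P" for p and y :: "real^'n"
    unfolding matrix_vector_mult_def padded_def vec_lambda_beta
    using that by (intro sum.mono_neutral_cong_right) auto
  have out_P: "(padded P G *v y) $ p = y $ p" if "p \<notin> P" for p and y :: "real^'n"
  proof -
    have "(padded P G *v y) $ p = (\<Sum>q\<in>UNIV. if q = p then y $ p else 0)"
      unfolding matrix_vector_mult_def padded_def vec_lambda_beta
      using that by (intro sum.cong) auto
    then show ?thesis by simp
  qed
  have "padded P G *v y = 0 \<longleftrightarrow>
      (\<forall>i. i \<notin> P \<longrightarrow> y $ i = 0) \<and> (\<forall>p\<in>P. (\<Sum>q\<in>P. G p q * y $ q) = 0)" for y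
  proof -
    have "(padded P G *v y) $ p = 0 \<longleftrightarrow>
        (p \<notin> P \<longrightarrow> y $ p = 0) \<and> (p \<in> P \<longrightarrow> (\<Sum>q\<in>P. G p q * y $ q) = 0)" for p
      by (cases "p \<in> P") (simp_all add: in_P out_P)
    then show ?thesis unfolding vec_eq_iff zero_index by blast
  qed
  then have "(\<exists>y. ?K y) \<longleftrightarrow> (\<exists>y. y \<noteq> 0 \<and> padded P G *v y = 0)" by auto
  also have "\<dots> \<longleftrightarrow> rank (padded P G) \<noteq> CARD('n)"
    by (rule matrix_nonfull_linear_equations_eq)
  also have "\<dots> \<longleftrightarrow> det (padded P G) = 0"
    using rank_bound[of "padded P G"] by (auto simp: det_eq_0_rank)
  finally show ?thesis by simp
qed

text \<open>
  Singularity is the vanishing of a determinant, hence a closed condition.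
\<close>
lemma singular_limit:
  fixes G :: "nat \<Rightarrow> 'n::finite \<Rightarrow> 'n \<Rightarrow> real"
  assumes "\<And>p q. p \<in> P \<Longrightarrow> q \<in> P \<Longrightarrow> (\<lambda>n. G n p q) \<longlonglongrightarrow> H p q"
    and "\<forall>\<^sub>F n in sequentially. \<exists>y::real^'n. y \<noteq> 0 \<and> (\<forall>i. i \<notin> P \<longrightarrow> y $ i = 0) \<and>
           (\<forall>p\<in>P. (\<Sum>q\<in>P. G n p q * y $ q) = 0)"
  shows "\<exists>y::real^'n. y \<noteq> 0 \<and> (\<forall>i. i \<notin> P \<longrightarrow> y $ i = 0) \<and>
           (\<forall>p\<in>P. (\<Sum>q\<in>P. H p q * y $ q) = 0)"
proof -
  have "(\<lambda>n. det (padded P (G n))) \<longlonglongrightarrow> det (padded P H)"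
    unfolding det_def
    by (intro tendsto_sum tendsto_mult tendsto_prod tendsto_const)
       (use assms(1) in \<open>auto simp: padded_def\<close>)
  moreover have "(\<lambda>n. det (padded P (G n))) \<longlonglongrightarrow> 0"
    using assms(2) unfolding det_padded_eq_0_iff[symmetric] by (rule tendsto_eventually)
  ultimately have "det (padded P H) = 0"
    by (rule LIMSEQ_unique)
  then show ?thesis unfolding det_padded_eq_0_iff .
qed

section \<open>The limiting Gram matrix\<close>

text \<open>
  The scales at which the near coordinates shrink. For \<open>N = 0\<close> the remainder is controlled only at the
  point \<open>0\<close> itself, so the sequence is constantly \<open>0\<close> there; \<open>0 ^ 0 = 1\<close> keeps all quotients
  meaningful.
\<close>
lemma scale_sequence:
  "\<exists>t :: nat \<Rightarrow> real. t \<longlonglongrightarrow> 0 \<and> (\<forall>n. 0 \<le> t n \<and> t n ^ N \<noteq> 0 \<and> (N = 0 \<longrightarrow> t n = 0))"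
proof (cases "N = 0")
  case True
  then show ?thesis by (intro exI[of _ "\<lambda>_. 0"]) simp
next
  case False
  then show ?thesis
    using LIMSEQ_inverse_real_of_nat by (intro exI[of _ "\<lambda>n. inverse (real (Suc n))"]) auto
qed

lemma peano_small_along_sequence:
  assumes small: "peano_small N S g" and s: "s \<longlonglongrightarrow> 0" "\<And>n. s n ^ N \<noteq> 0" "\<And>n. N = 0 \<Longrightarrow> s n = 0"
    and S: "\<forall>\<^sub>F n in sequentially. s n * a \<in> S"
  shows "(\<lambda>n. g (s n * a) / s n ^ N) \<longlonglongrightarrow> 0"
proof (cases "N = 0 \<or> a = 0")
  case True
  then have "(\<lambda>n. g (s n * a) / s n ^ N) = (\<lambda>_. 0)"
    using small s(3) by (auto simp: peano_small_def)
  then show ?thesis by simp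
next
  case False
  then have lim: "((\<lambda>x. g x / x ^ N) \<longlongrightarrow> 0) (at 0 within S)"
    using small by (auto simp: peano_small_def)
  have s0: "s n \<noteq> 0" for n using s(2)[of n] False by auto
  have "filterlim (\<lambda>n. s n * a) (at 0 within S) sequentially"
    unfolding filterlim_at
    using S s(1) False s0 by (auto intro: tendsto_mult_left_zero elim!: eventually_mono)
  from filterlim_compose[OF lim this]
  have "(\<lambda>n. a ^ N * (g (s n * a) / (s n * a) ^ N)) \<longlonglongrightarrow> 0"
    by (rule tendsto_mult_right_zero)
  moreover have "a ^ N * (g (s n * a) / (s n * a) ^ N) = g (s n * a) / s n ^ N" for n
    using False by (simp add: power_mult_distrib)
  ultimately show ?thesis by simp
qed

lemma entrywise_form_sum:
  "x \<bullet> (entrywise f (outer u) *v y) =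
     (\<Sum>a\<in>UNIV. \<Sum>b\<in>UNIV. x $ a * f (u $ a * u $ b) * y $ b)"
  by (simp add: inner_vec_def matrix_vector_mult_def entrywise_def outer_def sum_distrib_left
      mult.assoc)

lemma entrywise_form_diff:
  "x \<bullet> (entrywise f A *v y) =
     x \<bullet> (entrywise g A *v y) + x \<bullet> (entrywise (\<lambda>s. f s - g s) A *v y)"
proof -
  have "entrywise f A = entrywise g A + entrywise (\<lambda>s. f s - g s) A"
    by (simp add: entrywise_def vec_eq_iff)
  then show ?thesis
    by (metis inner_add_right matrix_vector_mult_add_rdistrib)
qed

text \<open>
  The indices in \<open>J\<close> are near: their coordinates \<open>t v\<^sub>a\<close> shrink with \<open>t\<close>, and there are as many of them as
  there are monomials in \<open>p\<close>. The indices in \<open>B\<close> are far and keep their coordinates \<open>w\<close>. Against the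
  test vectors \<open>X\<close>, the matrix of \<open>p\<close> is diagonal for every \<open>t\<close>. The entries of \<open>X\<close> are \<open>O(t^(- N))\<close> on
  \<open>J\<close> and \<open>O(1)\<close> on \<open>B\<close>, which is exactly what the remainder \<open>f - p\<close> at arguments of order \<open>t^2\<close>
  and \<open>t\<close> compensates; only its values at pairs of far coordinates survive.
\<close>
theorem gram_limit:
  fixes w :: "'n::finite \<Rightarrow> real" and J B :: "'n set"
  assumes disj: "J \<inter> B = {}" and m: "bij_betw m J {i. coeff p i \<noteq> 0}"
    and small: "peano_small (degree p) I (\<lambda>x. f x - poly p x)"
    and r: "0 < r" "{0..<r} \<subseteq> I"
    and w: "(\<forall>b\<in>B. 0 \<le> w b) \<or> {- r<..<r} \<subseteq> I"
    and ww: "\<forall>b\<in>B. \<forall>b'\<in>B. w b * w b' \<in> I"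
  shows "\<exists>(u :: nat \<Rightarrow> real^'n) (X :: nat \<Rightarrow> 'n \<Rightarrow> real^'n).
    (\<forall>\<^sub>F n in sequentially. \<forall>i j. u n $ i * u n $ j \<in> I) \<and>
    (\<forall>a\<in>J \<union> B. \<forall>b\<in>J \<union> B.
      (\<lambda>n. X n a \<bullet> (entrywise f (outer (u n)) *v X n b)) \<longlonglongrightarrow>
        (if a \<in> B \<and> b \<in> B then f (w a * w b) - poly p (w a * w b)
         else if a = b then coeff p (m a) else 0))"
proof -
  define N where "N = degree p"
  define g where "g x = f x - poly p x" for x
  have fin: "finite J" "finite B" by auto
  have m_le: "m i \<le> N" if "i \<in> J" for i
    using m that unfolding N_def by (auto simp: bij_betw_def intro: le_degree)
  obtain v :: "'n \<Rightarrow> real" and \<alpha> :: "'n \<Rightarrow> 'n \<Rightarrow> real" where v: "\<And>j. 0 < v j"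
    and dual: "\<forall>i\<in>J. \<forall>l\<in>J. (\<Sum>j\<in>J. \<alpha> i j * v j ^ m l) = (if i = l then 1 else 0)"
    using generalized_vandermonde_inverse[OF bij_betw_imp_inj_on[OF m]] by auto
  have \<alpha>: "(\<Sum>j\<in>J. \<alpha> i j * v j ^ m l) = (if i = l then 1 else 0)" if "i \<in> J" "l \<in> J" for i l
    using dual that by blast
  obtain t :: "nat \<Rightarrow> real" where t: "t \<longlonglongrightarrow> 0" "\<And>n. 0 \<le> t n" "\<And>n. t n ^ N \<noteq> 0" "\<And>n. N = 0 \<Longrightarrow> t n = 0"
    using scale_sequence[of N] by auto
  have tm: "t n ^ M \<noteq> 0" if "M \<le> N" for n M
    using t(3)[of n] that by (metis le_add_diff_inverse mult_zero_left power_add)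
  define u :: "nat \<Rightarrow> real^'n" where
    "u n = (\<chi> a. if a \<in> J then t n * v a else if a \<in> B then w a else 0)" for n
  \<comment> \<open>dual to the powers of the near coordinates; a far unit vector is corrected to be annihilated by them\<close>
  define X :: "nat \<Rightarrow> 'n \<Rightarrow> real^'n" where
    "X n q = (\<chi> a. if a \<in> J
       then if q \<in> J then \<alpha> q a / t n ^ m q else - (\<Sum>i\<in>J. w q ^ m i * (\<alpha> i a / t n ^ m i))
       else if a = q then 1 else 0)" for n q
  have I_small: "\<forall>\<^sub>F n in sequentially. s n * c \<in> I"
    if s: "s \<longlonglongrightarrow> 0" "\<And>n. 0 \<le> s n" and c: "0 \<le> c \<or> {- r<..<r} \<subseteq> I" for s :: "nat \<Rightarrow> real" and c
  proof -
    have "(\<lambda>n. s n * c) \<longlonglongrightarrow> 0" using s(1) by (rule tendsto_mult_left_zero)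
    then have "\<forall>\<^sub>F n in sequentially. dist (s n * c) 0 < r"
      using r(1) by (rule tendstoD)
    then show ?thesis
    proof eventually_elim
      case (elim n)
      show ?case
        using c
      proof
        assume "0 \<le> c"
        then have "0 \<le> s n * c" using s(2)[of n] by simp
        then show ?thesis using elim r(2) by (auto simp: dist_real_def)
      next
        assume "{- r<..<r} \<subseteq> I"
        then show ?thesis using elim by (auto simp: dist_real_def abs_less_iff)
      qed
    qed
  qed
  have t2: "(\<lambda>n. (t n)\<^sup>2) \<longlonglongrightarrow> 0" using tendsto_power[OF t(1), of 2] by simp
  have "0 \<in> I" using r by auto
  have inI: "\<forall>\<^sub>F n in sequentially. u n $ a * u n $ b \<in> I" for a b
  proof -
    consider "a \<in> J" "b \<in> J" | "a \<in> J" "b \<in> B" | "a \<in> B" "b \<in> J" | "a \<in> B" "b \<in> B"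
      | "a \<notin> J \<union> B \<or> b \<notin> J \<union> B" by blast
    then show ?thesis
    proof cases
      case 1
      have "\<forall>\<^sub>F n in sequentially. (t n)\<^sup>2 * (v a * v b) \<in> I"
        using I_small[OF t2] v[of a] v[of b] by simp
      then show ?thesis using 1 by (simp add: u_def power2_eq_square ac_simps)
    next
      case 2
      then have "0 \<le> v a * w b \<or> {- r<..<r} \<subseteq> I" using w v[of a] by auto
      then have "\<forall>\<^sub>F n in sequentially. t n * (v a * w b) \<in> I"
        using I_small[OF t(1,2)] by blast
      moreover have "b \<notin> J" using 2 disj by blast
      ultimately show ?thesis using 2 by (simp add: u_def ac_simps)
    next
      case 3
      then have "0 \<le> v b * w a \<or> {- r<..<r} \<subseteq> I" using w v[of b] by auto
      then have "\<forall>\<^sub>F n in sequentially. t n * (v b * w a) \<in> I"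
        using I_small[OF t(1,2)] by blast
      moreover have "a \<notin> J" using 3 disj by blast
      ultimately show ?thesis using 3 by (simp add: u_def ac_simps)
    next
      case 4
      moreover have "a \<notin> J" "b \<notin> J" using 4 disj by auto
      ultimately show ?thesis using ww by (simp add: u_def)
    next
      case 5
      then show ?thesis using \<open>0 \<in> I\<close> by (auto simp: u_def)
    qed
  qed
  have func_J: "power_functional (u n) (m l) (X n q) = (if q = l then 1 else 0)"
    if l: "l \<in> J" and q: "q \<in> J \<union> B" for n l q
  proof -
    have unit: "(\<Sum>a\<in>J. (\<alpha> i a / t n ^ m i) * (t n * v a) ^ m l) = (if i = l then 1 else 0)"
      if "i \<in> J" for i
    proof -
      have "(\<Sum>a\<in>J. (\<alpha> i a / t n ^ m i) * (t n * v a) ^ m l)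
          = t n ^ m l / t n ^ m i * (\<Sum>a\<in>J. \<alpha> i a * v a ^ m l)"
        by (simp add: sum_distrib_left power_mult_distrib ac_simps)
      also have "\<dots> = (if i = l then 1 else 0)"
        using \<alpha>[OF that l] tm[OF m_le[OF l], of n] by (cases "i = l") simp_all
      finally show ?thesis .
    qed
    have split: "power_functional (u n) (m l) (X n q) =
        (\<Sum>a\<in>J. X n q $ a * (t n * v a) ^ m l) + (\<Sum>a\<in>B. X n q $ a * w a ^ m l)"
    proof -
      have "power_functional (u n) (m l) (X n q) = (\<Sum>a\<in>J \<union> B. X n q $ a * u n $ a ^ m l)"
        unfolding power_functional_def
        by (rule sum.mono_neutral_right) (use q in \<open>auto simp: X_def\<close>)
      also have "\<dots> = (\<Sum>a\<in>J. X n q $ a * u n $ a ^ m l) + (\<Sum>a\<in>B. X n q $ a * u n $ a ^ m l)"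
        by (rule sum.union_disjoint[OF fin disj])
      also have "(\<Sum>a\<in>J. X n q $ a * u n $ a ^ m l) = (\<Sum>a\<in>J. X n q $ a * (t n * v a) ^ m l)"
        by (rule sum.cong) (auto simp: u_def)
      also have "(\<Sum>a\<in>B. X n q $ a * u n $ a ^ m l) = (\<Sum>a\<in>B. X n q $ a * w a ^ m l)"
        by (rule sum.cong) (use disj in \<open>auto simp: u_def\<close>)
      finally show ?thesis .
    qed
    show ?thesis
    proof (cases "q \<in> J")
      case True
      have "(\<Sum>a\<in>B. X n q $ a * w a ^ m l) = 0"
        by (rule sum.neutral) (use True disj in \<open>auto simp: X_def\<close>)
      moreover have "(\<Sum>a\<in>J. X n q $ a * (t n * v a) ^ m l)
          = (\<Sum>a\<in>J. (\<alpha> q a / t n ^ m q) * (t n * v a) ^ m l)"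
        by (rule sum.cong) (use True in \<open>auto simp: X_def\<close>)
      ultimately show ?thesis using split unit[OF True] by simp
    next
      case False
      then have "q \<in> B" using q by simp
      have "(\<Sum>a\<in>B. X n q $ a * w a ^ m l) = (\<Sum>a\<in>B. if a = q then w q ^ m l else 0)"
        by (rule sum.cong) (use disj in \<open>auto simp: X_def\<close>)
      also have "\<dots> = w q ^ m l" using \<open>q \<in> B\<close> by simp
      finally have B: "(\<Sum>a\<in>B. X n q $ a * w a ^ m l) = w q ^ m l" .
      have "(\<Sum>a\<in>J. X n q $ a * (t n * v a) ^ m l)
          = (\<Sum>a\<in>J. - (\<Sum>i\<in>J. w q ^ m i * ((\<alpha> i a / t n ^ m i) * (t n * v a) ^ m l)))"
        by (rule sum.cong) (use False in \<open>auto simp: X_def sum_distrib_right mult.assoc\<close>)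
      also have "\<dots> = - (\<Sum>i\<in>J. w q ^ m i * (\<Sum>a\<in>J. (\<alpha> i a / t n ^ m i) * (t n * v a) ^ m l))"
        unfolding sum_negf sum_distrib_left by (subst sum.swap) simp
      also have "(\<Sum>i\<in>J. w q ^ m i * (\<Sum>a\<in>J. (\<alpha> i a / t n ^ m i) * (t n * v a) ^ m l))
          = (\<Sum>i\<in>J. if i = l then w q ^ m l else 0)"
      proof (rule sum.cong)
        fix i assume "i \<in> J"
        show "w q ^ m i * (\<Sum>a\<in>J. (\<alpha> i a / t n ^ m i) * (t n * v a) ^ m l)
            = (if i = l then w q ^ m l else 0)"
          unfolding unit[OF \<open>i \<in> J\<close>] by simp
      qed simp
      also have "\<dots> = w q ^ m l" using l by simp
      finally show ?thesis using split B False l by auto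
    qed
  qed
  have poly_part: "X n a \<bullet> (entrywise (poly p) (outer (u n)) *v X n b) =
      (if a \<in> J \<and> a = b then coeff p (m a) else 0)"
    if "a \<in> J \<union> B" "b \<in> J \<union> B" for n a b
  proof -
    have "X n a \<bullet> (entrywise (poly p) (outer (u n)) *v X n b) =
        (\<Sum>l\<in>J. coeff p (m l) * power_functional (u n) (m l) (X n a)
            * power_functional (u n) (m l) (X n b))"
      by (subst entrywise_poly_outer_form[where p = p])
         (simp_all add: sum.reindex_bij_betw[OF m, symmetric])
    also have "\<dots> = (\<Sum>l\<in>J. if l = a then if a = b then coeff p (m a) else 0 else 0)"
      by (rule sum.cong) (use that in \<open>auto simp: func_J\<close>)
    finally show ?thesis by auto
  qed
  \<comment> \<open>quantifies the blow-up: the entries at near indices grow at most like \<open>t^(- N)\<close>\<close>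
  have X_scaled: "\<exists>L. (\<lambda>n. X n q $ a * t n ^ N) \<longlonglongrightarrow> L" if a: "a \<in> J" for q a
  proof -
    have quot: "c / t n ^ m i * t n ^ N = c * t n ^ (N - m i)" if "i \<in> J" for i n c
      using tm[OF m_le[OF that], of n] m_le[OF that]
      by (simp add: field_simps flip: power_add)
    have lim: "(\<lambda>n. c * t n ^ M) \<longlonglongrightarrow> c * 0 ^ M" for c M
      by (intro tendsto_intros t(1))
    show ?thesis
    proof (cases "q \<in> J")
      case True
      then have "X n q $ a = \<alpha> q a / t n ^ m q" for n using a by (simp add: X_def)
      then have "(\<lambda>n. X n q $ a * t n ^ N) = (\<lambda>n. \<alpha> q a * t n ^ (N - m q))"
        using quot[OF True] by presburger
      then show ?thesis using lim by metis
    next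
      case False
      have "X n q $ a * t n ^ N = - (\<Sum>i\<in>J. (w q ^ m i * \<alpha> i a) * t n ^ (N - m i))" for n
      proof -
        have "X n q $ a * t n ^ N = - (\<Sum>i\<in>J. w q ^ m i * (\<alpha> i a / t n ^ m i)) * t n ^ N"
          using False a by (simp add: X_def)
        also have "\<dots> = - (\<Sum>i\<in>J. (w q ^ m i * \<alpha> i a) * t n ^ (N - m i))"
          unfolding minus_mult_left[symmetric] sum_distrib_right
          by (intro arg_cong[of _ _ uminus] sum.cong refl) (simp only: quot mult.assoc)
        finally show ?thesis .
      qed
      moreover have "(\<lambda>n. - (\<Sum>i\<in>J. (w q ^ m i * \<alpha> i a) * t n ^ (N - m i))) \<longlonglongrightarrow>
          - (\<Sum>i\<in>J. (w q ^ m i * \<alpha> i a) * 0 ^ (N - m i))"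
        by (intro tendsto_minus tendsto_sum lim)
      ultimately show ?thesis by auto
    qed
  qed
  have g_JJ: "(\<lambda>n. g (t n * v a * (t n * v b)) / (t n ^ N * t n ^ N)) \<longlonglongrightarrow> 0" for a b
  proof -
    have "(\<lambda>n. g ((t n)\<^sup>2 * (v a * v b)) / ((t n)\<^sup>2) ^ N) \<longlonglongrightarrow> 0"
    proof (rule peano_small_along_sequence[OF _ t2])
      show "peano_small N I g" using small by (simp add: N_def g_def[abs_def])
      show "\<forall>\<^sub>F n in sequentially. (t n)\<^sup>2 * (v a * v b) \<in> I"
        using I_small[OF t2] v[of a] v[of b] by simp
    qed (use t in auto)
    then show ?thesis
      by (simp add: power2_eq_square power_mult_distrib ac_simps)
  qed
  have g_JB: "(\<lambda>n. g (t n * (v a * w b)) / t n ^ N) \<longlonglongrightarrow> 0" if "b \<in> B" for a b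
  proof (rule peano_small_along_sequence[OF _ t(1)])
    show "peano_small N I g" using small by (simp add: N_def g_def[abs_def])
    have "0 \<le> v a * w b \<or> {- r<..<r} \<subseteq> I" using w v[of a] that by auto
    then show "\<forall>\<^sub>F n in sequentially. t n * (v a * w b) \<in> I"
      using I_small[OF t(1,2)] by blast
  qed (use t in auto)
  have term_lim: "(\<lambda>n. X n c $ a * g (u n $ a * u n $ b) * X n d $ b) \<longlonglongrightarrow>
      (if a \<in> B \<and> b \<in> B \<and> a = c \<and> b = d then g (w c * w d) else 0)"
    if cd: "c \<in> J \<union> B" "d \<in> J \<union> B" for a b c d
  proof -
    consider "a \<in> J" "b \<in> J" | "a \<in> J" "b \<in> B" | "a \<in> B" "b \<in> J" | "a \<in> B" "b \<in> B"
      | "a \<notin> J \<union> B \<or> b \<notin> J \<union> B" by blast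
    then show ?thesis
    proof cases
      case 1
      obtain L M where L: "(\<lambda>n. X n c $ a * t n ^ N) \<longlonglongrightarrow> L" and M: "(\<lambda>n. X n d $ b * t n ^ N) \<longlonglongrightarrow> M"
        using X_scaled 1 by meson
      have "(\<lambda>n. (X n c $ a * t n ^ N) * (X n d $ b * t n ^ N) *
            (g (t n * v a * (t n * v b)) / (t n ^ N * t n ^ N))) \<longlonglongrightarrow> L * M * 0"
        by (intro tendsto_mult L M g_JJ)
      moreover have "(X n c $ a * t n ^ N) * (X n d $ b * t n ^ N) *
            (g (t n * v a * (t n * v b)) / (t n ^ N * t n ^ N)) =
          X n c $ a * g (u n $ a * u n $ b) * X n d $ b" for n
        using 1 t(3)[of n] by (auto simp: u_def)
      ultimately show ?thesis using 1 disj by auto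
    next
      case 2
      then have b: "b \<notin> J" using disj by blast
      obtain L where L: "(\<lambda>n. X n c $ a * t n ^ N) \<longlonglongrightarrow> L" using X_scaled 2 by meson
      have "(\<lambda>n. (X n c $ a * t n ^ N) * (g (t n * (v a * w b)) / t n ^ N) * (if b = d then 1 else 0))
          \<longlonglongrightarrow> L * 0 * (if b = d then 1 else 0)"
        by (intro tendsto_mult L g_JB tendsto_const 2)
      moreover have "(X n c $ a * t n ^ N) * (g (t n * (v a * w b)) / t n ^ N) * (if b = d then 1 else 0) =
          X n c $ a * g (u n $ a * u n $ b) * X n d $ b" for n
      proof -
        have "X n d $ b = (if b = d then 1 else 0)" using b by (simp add: X_def)
        then show ?thesis using 2 b t(3)[of n] by (auto simp: u_def mult.assoc)
      qed
      ultimately show ?thesis using 2 disj by auto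
    next
      case 3
      then have a: "a \<notin> J" using disj by blast
      obtain L where L: "(\<lambda>n. X n d $ b * t n ^ N) \<longlonglongrightarrow> L" using X_scaled 3 by meson
      have "(\<lambda>n. (X n d $ b * t n ^ N) * (g (t n * (v b * w a)) / t n ^ N) * (if a = c then 1 else 0))
          \<longlonglongrightarrow> L * 0 * (if a = c then 1 else 0)"
        by (intro tendsto_mult L g_JB tendsto_const 3)
      moreover have "(X n d $ b * t n ^ N) * (g (t n * (v b * w a)) / t n ^ N) * (if a = c then 1 else 0) =
          X n c $ a * g (u n $ a * u n $ b) * X n d $ b" for n
      proof -
        have "X n c $ a = (if a = c then 1 else 0)" using a by (simp add: X_def)
        then show ?thesis using 3 a t(3)[of n] by (auto simp: u_def ac_simps)
      qed
      ultimately show ?thesis using 3 disj by auto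
    next
      case 4
      then have "a \<notin> J" "b \<notin> J" using disj by auto
      then show ?thesis using 4 by (auto simp: X_def u_def)
    next
      case 5
      then show ?thesis using cd by (auto simp: X_def)
    qed
  qed
  have g_part: "(\<lambda>n. X n c \<bullet> (entrywise g (outer (u n)) *v X n d)) \<longlonglongrightarrow>
      (if c \<in> B \<and> d \<in> B then g (w c * w d) else 0)"
    if cd: "c \<in> J \<union> B" "d \<in> J \<union> B" for c d
  proof -
    have "(\<lambda>n. X n c \<bullet> (entrywise g (outer (u n)) *v X n d)) \<longlonglongrightarrow>
      (\<Sum>a\<in>UNIV. \<Sum>b\<in>UNIV. if a \<in> B \<and> b \<in> B \<and> a = c \<and> b = d then g (w c * w d) else 0)"
      unfolding entrywise_form_sum by (intro tendsto_sum term_lim cd)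
    also have "(\<Sum>a\<in>UNIV. \<Sum>b\<in>UNIV. if a \<in> B \<and> b \<in> B \<and> a = c \<and> b = d then g (w c * w d) else 0)
        = (\<Sum>a\<in>UNIV. if a = c then (\<Sum>b\<in>UNIV. if b = d then if c \<in> B \<and> d \<in> B then g (w c * w d) else 0 else 0) else 0)"
    proof (rule sum.cong)
      fix a
      have "(\<Sum>b\<in>UNIV. if c \<in> B \<and> b \<in> B \<and> b = d then g (w c * w d) else 0)
          = (\<Sum>b\<in>UNIV. if b = d then if c \<in> B \<and> d \<in> B then g (w c * w d) else 0 else 0)"
        by (rule sum.cong) auto
      then show "(\<Sum>b\<in>UNIV. if a \<in> B \<and> b \<in> B \<and> a = c \<and> b = d then g (w c * w d) else 0)
          = (if a = c then (\<Sum>b\<in>UNIV. if b = d then if c \<in> B \<and> d \<in> B then g (w c * w d) else 0 else 0) else 0)"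
        by (cases "a = c") simp_all
    qed simp
    also have "\<dots> = (if c \<in> B \<and> d \<in> B then g (w c * w d) else 0)"
      by simp
    finally show ?thesis .
  qed
  show ?thesis
  proof (intro exI conjI ballI)
    show "\<forall>\<^sub>F n in sequentially. \<forall>i j. u n $ i * u n $ j \<in> I"
      using inI by (simp add: eventually_all_finite)
  next
    fix a b assume ab: "a \<in> J \<union> B" "b \<in> J \<union> B"
    have "(\<lambda>n. (if a \<in> J \<and> a = b then coeff p (m a) else 0) + X n a \<bullet> (entrywise g (outer (u n)) *v X n b))
        \<longlonglongrightarrow> (if a \<in> J \<and> a = b then coeff p (m a) else 0) + (if a \<in> B \<and> b \<in> B then g (w a * w b) else 0)"
      by (intro tendsto_add tendsto_const g_part ab)
    moreover have "X n a \<bullet> (entrywise f (outer (u n)) *v X n b) =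
        (if a \<in> J \<and> a = b then coeff p (m a) else 0) + X n a \<bullet> (entrywise g (outer (u n)) *v X n b)" for n
      unfolding entrywise_form_diff[of _ f _ _ "poly p"] poly_part[OF ab] g_def ..
    moreover have "(if a \<in> J \<and> a = b then coeff p (m a) else 0) + (if a \<in> B \<and> b \<in> B then g (w a * w b) else 0)
       = (if a \<in> B \<and> b \<in> B then f (w a * w b) - poly p (w a * w b)
         else if a = b then coeff p (m a) else 0)"
      using ab disj by (auto simp: g_def)
    ultimately show "(\<lambda>n. X n a \<bullet> (entrywise f (outer (u n)) *v X n b)) \<longlonglongrightarrow>
        (if a \<in> B \<and> b \<in> B then f (w a * w b) - poly p (w a * w b)
         else if a = b then coeff p (m a) else 0)"
      by simp
  qed
qed

section \<open>Nonnegative arguments\<close>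

text \<open>
  The limit is block diagonal and singular, and its near block is the diagonal matrix of the nonzero
  coefficients of \<open>p\<close>; so a kernel vector lives on the far block.
\<close>
lemma far_block_singular:
  fixes w :: "'n::finite \<Rightarrow> real" and J B :: "'n set"
  assumes disj: "J \<inter> B = {}" and m: "bij_betw m J {i. coeff p i \<noteq> 0}"
    and small: "peano_small (degree p) I (\<lambda>x. f x - poly p x)"
    and r: "0 < r" "{0..<r} \<subseteq> I"
    and w: "(\<forall>b\<in>B. 0 \<le> w b) \<or> {- r<..<r} \<subseteq> I"
    and ww: "\<forall>b\<in>B. \<forall>b'\<in>B. w b * w b' \<in> I"
    and rank: "entrywise f \<in> (psd_mats_rank_le 1 I :: (real^'n^'n) set) \<rightarrow> sym_mats_rank_le k UNIV"
    and k: "k < card (J \<union> B)"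
  shows "\<exists>y::real^'n. y \<noteq> 0 \<and> (\<forall>i. i \<notin> B \<longrightarrow> y $ i = 0) \<and>
    (\<forall>b\<in>B. (\<Sum>b'\<in>B. (f (w b * w b') - poly p (w b * w b')) * y $ b') = 0)"
proof -
  let ?H = "\<lambda>a b. if a \<in> B \<and> b \<in> B then f (w a * w b) - poly p (w a * w b)
         else if a = b then coeff p (m a) else 0"
  obtain u :: "nat \<Rightarrow> real^'n" and X :: "nat \<Rightarrow> 'n \<Rightarrow> real^'n"
    where uI: "\<forall>\<^sub>F n in sequentially. \<forall>i j. u n $ i * u n $ j \<in> I"
    and limits: "\<forall>a\<in>J \<union> B. \<forall>b\<in>J \<union> B.
      (\<lambda>n. X n a \<bullet> (entrywise f (outer (u n)) *v X n b)) \<longlonglongrightarrow> ?H a b"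
    using gram_limit[OF disj m small r w ww] by blast
  have lim: "(\<lambda>n. X n a \<bullet> (entrywise f (outer (u n)) *v X n b)) \<longlonglongrightarrow> ?H a b"
    if "a \<in> J \<union> B" "b \<in> J \<union> B" for a b
    using limits that by blast
  have "\<exists>y::real^'n. y \<noteq> 0 \<and> (\<forall>i. i \<notin> J \<union> B \<longrightarrow> y $ i = 0) \<and>
      (\<forall>a\<in>J \<union> B. (\<Sum>b\<in>J \<union> B. ?H a b * y $ b) = 0)"
  proof (rule singular_limit[where G = "\<lambda>n a b. X n a \<bullet> (entrywise f (outer (u n)) *v X n b)"])
    show "\<forall>\<^sub>F n in sequentially. \<exists>y::real^'n. y \<noteq> 0 \<and> (\<forall>i. i \<notin> J \<union> B \<longrightarrow> y $ i = 0) \<and>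
      (\<forall>a\<in>J \<union> B. (\<Sum>b\<in>J \<union> B. (X n a \<bullet> (entrywise f (outer (u n)) *v X n b)) * y $ b) = 0)"
      using uI
    proof eventually_elim
      case (elim n)
      let ?A = "entrywise f (outer (u n))"
      have "outer (u n) \<in> psd_mats_rank_le 1 I"
        using elim by (intro outer_in_psd_rank_one) blast
      then have "rank ?A \<le> k"
        using rank by (auto simp: sym_mats_rank_le_def)
      then have "rank ?A < card (J \<union> B)" using k by simp
      then obtain y :: "real^'n" where y: "y \<noteq> 0" "\<And>i. i \<notin> J \<union> B \<Longrightarrow> y $ i = 0"
        "?A *v (\<Sum>b\<in>J \<union> B. y $ b *\<^sub>R X n b) = 0"
        using kernel_of_frame[of ?A "J \<union> B" "X n"] by blast
      have "(\<Sum>b\<in>J \<union> B. (X n a \<bullet> (?A *v X n b)) * y $ b)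
          = X n a \<bullet> (?A *v (\<Sum>b\<in>J \<union> B. y $ b *\<^sub>R X n b))" for a
        by (simp add: linear_sum[OF matrix_vector_mul_linear] inner_sum_right
            matrix_vector_mult_scaleR mult.commute)
      then show ?case using y by auto
    qed
  qed (rule lim)
  then obtain y :: "real^'n" where y: "y \<noteq> 0" "\<And>i. i \<notin> J \<union> B \<Longrightarrow> y $ i = 0"
    and ker: "\<And>a. a \<in> J \<union> B \<Longrightarrow> (\<Sum>b\<in>J \<union> B. ?H a b * y $ b) = 0" by blast
  have yJ: "y $ j = 0" if "j \<in> J" for j
  proof -
    have "j \<notin> B" using that disj by blast
    have "0 = (\<Sum>b\<in>J \<union> B. ?H j b * y $ b)" using ker[of j] that by simp
    also have "\<dots> = (\<Sum>b\<in>J \<union> B. if b = j then coeff p (m j) * y $ j else 0)"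
      using \<open>j \<notin> B\<close> by (intro sum.cong) auto
    also have "\<dots> = coeff p (m j) * y $ j" using that by simp
    finally show ?thesis using m that by (auto simp: bij_betw_def)
  qed
  have "(\<Sum>b'\<in>B. (f (w b * w b') - poly p (w b * w b')) * y $ b') = 0" if "b \<in> B" for b
  proof -
    have "0 = (\<Sum>b'\<in>J \<union> B. ?H b b' * y $ b')" using ker[of b] that by simp
    also have "\<dots> = (\<Sum>b'\<in>B. (f (w b * w b') - poly p (w b * w b')) * y $ b')"
      using that yJ by (intro sum.mono_neutral_cong_right) auto
    finally show ?thesis by simp
  qed
  then show ?thesis using y yJ by (metis Un_iff)
qed

text \<open>
  The diagonal entries of the limiting Gram matrix are limits of values of a nonnegative quadratic
  form.
\<close>
lemma gram_limit_nonneg: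
  fixes w :: "'n::finite \<Rightarrow> real" and J B :: "'n set"
  assumes disj: "J \<inter> B = {}" and m: "bij_betw m J {i. coeff p i \<noteq> 0}"
    and small: "peano_small (degree p) I (\<lambda>x. f x - poly p x)"
    and r: "0 < r" "{0..<r} \<subseteq> I"
    and w: "(\<forall>b\<in>B. 0 \<le> w b) \<or> {- r<..<r} \<subseteq> I"
    and ww: "\<forall>b\<in>B. \<forall>b'\<in>B. w b * w b' \<in> I"
    and psd: "entrywise f \<in> (psd_mats_rank_le 1 I :: (real^'n^'n) set) \<rightarrow> psd_mats UNIV"
  shows "j \<in> J \<Longrightarrow> 0 \<le> coeff p (m j)" and "b \<in> B \<Longrightarrow> 0 \<le> f (w b * w b) - poly p (w b * w b)"
proof -
  let ?H = "\<lambda>a b. if a \<in> B \<and> b \<in> B then f (w a * w b) - poly p (w a * w b)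
         else if a = b then coeff p (m a) else 0"
  obtain u :: "nat \<Rightarrow> real^'n" and X :: "nat \<Rightarrow> 'n \<Rightarrow> real^'n"
    where uI: "\<forall>\<^sub>F n in sequentially. \<forall>i j. u n $ i * u n $ j \<in> I"
    and limits: "\<forall>a\<in>J \<union> B. \<forall>b\<in>J \<union> B.
      (\<lambda>n. X n a \<bullet> (entrywise f (outer (u n)) *v X n b)) \<longlonglongrightarrow> ?H a b"
    using gram_limit[OF disj m small r w ww] by blast
  have lim: "(\<lambda>n. X n a \<bullet> (entrywise f (outer (u n)) *v X n b)) \<longlonglongrightarrow> ?H a b"
    if "a \<in> J \<union> B" "b \<in> J \<union> B" for a b
    using limits that by blast
  have H: "0 \<le> ?H a a" if "a \<in> J \<union> B" for a
  proof (rule tendsto_lowerbound[OF lim[OF that that]])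
    show "\<forall>\<^sub>F n in sequentially. 0 \<le> X n a \<bullet> (entrywise f (outer (u n)) *v X n a)"
      using uI
    proof eventually_elim
      case (elim n)
      have "outer (u n) \<in> psd_mats_rank_le 1 I"
        using elim by (intro outer_in_psd_rank_one) blast
      then show ?case using psd by (auto simp: psd_mats_def)
    qed
  qed simp
  show "0 \<le> coeff p (m j)" if "j \<in> J" using H[of j] that disj by (auto split: if_splits)
  show "0 \<le> f (w b * w b) - poly p (w b * w b)" if "b \<in> B" using H[of b] that by simp
qed

lemma near_and_far_indices:
  assumes "card (S :: nat set) + s \<le> CARD('n::finite)" and "finite S"
  obtains J B :: "'n::finite set" and m :: "'n \<Rightarrow> nat"
  where "J \<inter> B = {}" and "card B = s" and "bij_betw m J S"
proof -
  obtain J :: "'n set" where J: "card J = card S"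
    using assms by (meson add_leE obtain_subset_with_card_n)
  have "s \<le> card (- J)"
    using assms J by (simp add: Compl_eq_Diff_UNIV card_Diff_subset)
  then obtain B where B: "B \<subseteq> - J" "card B = s"
    by (meson obtain_subset_with_card_n)
  obtain m where "bij_betw m J S"
    using finite_same_card_bij[OF _ \<open>finite S\<close> J] by auto
  then show ?thesis using that B by blast
qed

text \<open>
  With one far coordinate \<open>sqrt x\<close> the far block is the number \<open>f x - p x\<close>.
\<close>
theorem rank_forces_taylor_polynomial_nonneg:
  assumes small: "peano_small (degree p) I (\<lambda>x. f x - poly p x)"
    and r: "0 < r" "{0..<r} \<subseteq> I"
    and rank: "entrywise f \<in> (psd_mats_rank_le 1 I :: (real^'n^'n) set) \<rightarrow> sym_mats_rank_le k UNIV"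
    and k: "card {i. coeff p i \<noteq> 0} = k" "k < CARD('n::finite)"
    and x: "x \<in> I" "0 \<le> x"
  shows "f x = poly p x"
proof -
  obtain J B :: "'n set" and m where JB: "J \<inter> B = {}" "card B = 1"
    and m: "bij_betw m J {i. coeff p i \<noteq> 0}"
    by (rule near_and_far_indices[where 'n = 'n, of "{i. coeff p i \<noteq> 0}" 1])
       (use k in \<open>simp_all add: finite_coeff_support\<close>)
  obtain b where b: "B = {b}" using JB(2) card_1_singletonE by blast
  have "card (J \<union> B) = k + 1"
    using JB k bij_betw_same_card[OF m] by (subst card_Un_disjoint) auto
  then have "\<exists>y::real^'n. y \<noteq> 0 \<and> (\<forall>i. i \<notin> B \<longrightarrow> y $ i = 0) \<and>
    (\<forall>b\<in>B. (\<Sum>b'\<in>B. (f (sqrt x * sqrt x) - poly p (sqrt x * sqrt x)) * y $ b') = 0)"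
    using x by (intro far_block_singular[OF JB(1) m small r _ _ rank]) auto
  then obtain y :: "real^'n" where y: "y \<noteq> 0" "\<And>i. i \<noteq> b \<Longrightarrow> y $ i = 0"
      "(f x - poly p x) * y $ b = 0"
    using x(2) by (auto simp: b)
  have "y $ b \<noteq> 0"
    using y(1,2) by (metis vec_eq_iff zero_index)
  then show ?thesis using y(3) by simp
qed

theorem psd_forces_positive_taylor:
  assumes small: "peano_small (degree p) I (\<lambda>x. f x - poly p x)"
    and r: "0 < r" "{0..<r} \<subseteq> I"
    and psd: "entrywise f \<in> (psd_mats_rank_le 1 I :: (real^'n^'n) set) \<rightarrow> psd_mats UNIV"
    and k: "card {i. coeff p i \<noteq> 0} < CARD('n::finite)"
  shows "0 \<le> coeff p i" and "x \<in> I \<Longrightarrow> 0 \<le> x \<Longrightarrow> poly p x \<le> f x"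
proof -
  obtain J B :: "'n set" and m where JB: "J \<inter> B = {}" "card B = 1"
    and m: "bij_betw m J {i. coeff p i \<noteq> 0}"
    by (rule near_and_far_indices[where 'n = 'n, of "{i. coeff p i \<noteq> 0}" 1])
       (use k in \<open>simp_all add: finite_coeff_support\<close>)
  obtain b where b: "B = {b}" using JB(2) card_1_singletonE by blast
  have main: "(j \<in> J \<longrightarrow> 0 \<le> coeff p (m j)) \<and> poly p x \<le> f x" if "x \<in> I" "0 \<le> x" for x j
    using gram_limit_nonneg[OF JB(1) m small r _ _ psd, of "\<lambda>_. sqrt x"] that b by auto
  show "0 \<le> coeff p i"
  proof (cases "coeff p i = 0")
    case False
    then obtain j where "j \<in> J" "i = m j" using m by (auto simp: bij_betw_def)
    then show ?thesis using main[of 0] r by auto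
  qed simp
  show "poly p x \<le> f x" if "x \<in> I" "0 \<le> x" using main that by blast
qed

text \<open>
  With the far coordinates \<open>sqrt x\<close> and \<open>- sqrt x\<close> the far block is a symmetric \<open>2 \<times> 2\<close> matrix with
  equal diagonal entries; it is singular only if its entries agree up to sign.
\<close>
lemma rank_forces_equal_magnitudes:
  assumes small: "peano_small (degree p) I (\<lambda>x. f x - poly p x)"
    and r: "0 < r" "{- r<..<r} \<subseteq> I"
    and rank: "entrywise f \<in> (psd_mats_rank_le 1 I :: (real^'n^'n) set) \<rightarrow> sym_mats_rank_le k UNIV"
    and k: "card {i. coeff p i \<noteq> 0} + 1 = k" "k < CARD('n::finite)"
    and x: "x \<in> I" "- x \<in> I" "0 \<le> x"
  shows "\<bar>f (- x) - poly p (- x)\<bar> = \<bar>f x - poly p x\<bar>"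
proof -
  obtain J B :: "'n set" and m where JB: "J \<inter> B = {}" "card B = 2"
    and m: "bij_betw m J {i. coeff p i \<noteq> 0}"
    by (rule near_and_far_indices[where 'n = 'n, of "{i. coeff p i \<noteq> 0}" 2])
       (use k in \<open>simp_all add: finite_coeff_support\<close>)
  obtain b c where b: "B = {b, c}" "b \<noteq> c" using JB(2) by (auto simp: card_2_iff)
  have card: "k < card (J \<union> B)"
    using JB k bij_betw_same_card[OF m] by (subst card_Un_disjoint) auto
  have r': "{0..<r} \<subseteq> I" using r by auto
  define w where "w i = (if i = b then sqrt x else - sqrt x)" for i
  have "\<exists>y::real^'n. y \<noteq> 0 \<and> (\<forall>i. i \<notin> B \<longrightarrow> y $ i = 0) \<and>
    (\<forall>b\<in>B. (\<Sum>b'\<in>B. (f (w b * w b') - poly p (w b * w b')) * y $ b') = 0)"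
    by (rule far_block_singular[OF JB(1) m small r(1) r' _ _ rank card])
       (use x r(2) in \<open>auto simp: w_def\<close>)
  then obtain y :: "real^'n" where y: "y \<noteq> 0" "\<And>i. i \<notin> B \<Longrightarrow> y $ i = 0"
    and ker: "\<And>a. a \<in> B \<Longrightarrow> (\<Sum>b'\<in>B. (f (w a * w b') - poly p (w a * w b')) * y $ b') = 0" by blast
  define s d where "s = f x - poly p x" and "d = f (- x) - poly p (- x)"
  have e: "s * y $ b + d * y $ c = 0" "d * y $ b + s * y $ c = 0"
    using ker[of b] ker[of c] b x(3) by (auto simp: w_def s_def d_def)
  have "y $ b \<noteq> 0 \<or> y $ c \<noteq> 0"
  proof (rule ccontr)
    assume "\<not> ?thesis"
    then have "y $ i = 0" for i using y(2)[of i] b by (cases "i \<in> B") auto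
    then show False using y(1) by (simp add: vec_eq_iff)
  qed
  moreover have "(s\<^sup>2 - d\<^sup>2) * y $ b = s * (s * y $ b + d * y $ c) - d * (d * y $ b + s * y $ c)"
    "(s\<^sup>2 - d\<^sup>2) * y $ c = s * (d * y $ b + s * y $ c) - d * (s * y $ b + d * y $ c)"
    by (simp_all add: algebra_simps power2_eq_square)
  ultimately have "s\<^sup>2 = d\<^sup>2" unfolding e by auto
  then show ?thesis unfolding s_def d_def by (simp add: power2_eq_iff abs_eq_iff) auto
qed

section \<open>Negative arguments\<close>

lemma peano_small_drop_leading_term:
  assumes small: "peano_small (degree p) S (\<lambda>x. f x - poly p x)"
    and q: "degree q < degree p" and p: "p = q + monom c (degree p)"
  shows "peano_small (degree q) S (\<lambda>x. f x - poly q x)"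
proof -
  let ?N = "degree p" and ?M = "degree q"
  have split: "f x - poly q x = (f x - poly p x) + c * x ^ ?N" for x
    using arg_cong[OF p, of "\<lambda>r. poly r x"] by (simp add: poly_monom)
  have lim: "((\<lambda>x. (f x - poly p x) / x ^ ?N) \<longlongrightarrow> 0) (at 0 within S)" and f0: "f 0 - poly p 0 = 0"
    using small q by (auto simp: peano_small_def)
  have "((\<lambda>x. ((f x - poly p x) / x ^ ?N + c) * x ^ (?N - ?M)) \<longlongrightarrow> (0 + c) * 0 ^ (?N - ?M)) (at 0 within S)"
    by (intro tendsto_intros lim)
  moreover have "((f x - poly p x) / x ^ ?N + c) * x ^ (?N - ?M) = (f x - poly q x) / x ^ ?M"
    if "x \<noteq> 0" for x
    unfolding split[of x] using that q
    by (simp add: power_diff add_divide_distrib distrib_right)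
  ultimately have "((\<lambda>x. (f x - poly q x) / x ^ ?M) \<longlongrightarrow> 0) (at 0 within S)"
    using q by (elim Lim_transform_eventually[rotated, THEN tendsto_eq_rhs, rotated])
      (auto simp: eventually_at_filter)
  moreover have "f 0 - poly q 0 = 0" using f0 q split[of 0] by simp
  ultimately show ?thesis by (simp add: peano_small_def)
qed

lemma peano_small_strict_bound:
  assumes "peano_small N S g" and "0 < N" and "0 < c"
  obtains e where "0 < e" and "\<And>x. x \<in> S \<Longrightarrow> x \<noteq> 0 \<Longrightarrow> \<bar>x\<bar> < e \<Longrightarrow> \<bar>g x\<bar> < c * \<bar>x\<bar> ^ N"
proof -
  have "\<forall>\<^sub>F x in at 0 within S. dist (g x / x ^ N) 0 < c"
    using assms by (intro tendstoD) (auto simp: peano_small_def)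
  then obtain e where "0 < e" and e: "\<And>x. x \<in> S \<Longrightarrow> x \<noteq> 0 \<Longrightarrow> \<bar>x\<bar> < e \<Longrightarrow> \<bar>g x / x ^ N\<bar> < c"
    unfolding eventually_at by (auto simp: dist_real_def)
  have "\<bar>g x\<bar> < c * \<bar>x\<bar> ^ N" if "x \<in> S" "x \<noteq> 0" "\<bar>x\<bar> < e" for x
    using e[OF that] that by (simp add: power_abs divide_less_eq)
  then show ?thesis using that \<open>0 < e\<close> by blast
qed

text \<open>
  The coordinates are \<open>t\<close>, \<open>w = sqrt y\<close> and \<open>- w\<close>. The minor with rows \<open>t, w\<close> and columns \<open>t, - w\<close>
  contains \<open>f(- y)\<close> and otherwise only values at nonnegative arguments and \<open>f(- t w)\<close>, which the Taylor
  expansion controls as \<open>t\<close> tends to \<open>0\<close>.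
\<close>
lemma monomial_case_negative:
  fixes f :: "real \<Rightarrow> real"
  assumes small: "peano_small N I (\<lambda>x. f x - c * x ^ N)" and "c \<noteq> 0"
    and rank: "entrywise f \<in> (psd_mats_rank_le 1 I :: (real^'n^'n) set) \<rightarrow> sym_mats_rank_le 1 UNIV"
    and n: "3 \<le> CARD('n::finite)"
    and nonneg: "\<And>x. x \<in> I \<Longrightarrow> 0 \<le> x \<Longrightarrow> f x = c * x ^ N"
    and r: "0 < r" "{- r<..<r} \<subseteq> I" and y: "0 \<le> y" "y \<in> I" "- y \<in> I"
  shows "f (- y) = c * (- y) ^ N"
proof -
  obtain T :: "'n set" where "card T = 3" using n by (meson obtain_subset_with_card_n)
  then obtain a b d :: 'n where ne: "a \<noteq> b" "a \<noteq> d" "b \<noteq> d" by (auto simp: card_3_iff)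
  define w where "w = sqrt y"
  have ww: "w * w = y" "0 \<le> w" using y by (simp_all add: w_def)
  obtain t :: "nat \<Rightarrow> real" where t: "t \<longlonglongrightarrow> 0" "\<And>n. 0 \<le> t n" "\<And>n. t n ^ N \<noteq> 0" "\<And>n. N = 0 \<Longrightarrow> t n = 0"
    using scale_sequence[of N] by auto
  have in_I: "\<forall>\<^sub>F n in sequentially. s n \<in> I" if "s \<longlonglongrightarrow> 0" for s
    using tendstoD[OF that r(1)] r(2)
    by (auto elim!: eventually_mono simp: dist_real_def abs_less_iff subset_iff)
  have tw: "(\<lambda>n. t n * x) \<longlonglongrightarrow> 0" for x using t(1) by (rule tendsto_mult_left_zero)
  have tt: "(\<lambda>n. t n * t n) \<longlonglongrightarrow> 0" using tendsto_mult[OF t(1) t(1)] by simp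
  have "\<forall>\<^sub>F n in sequentially. f (- y) = w ^ N * (f (t n * - w) / t n ^ N)"
    using in_I[OF tt] in_I[OF tw[of w]] in_I[OF tw[of "- w"]]
  proof eventually_elim
    case (elim n)
    define u :: "real^'n" where
      "u = (\<chi> i. if i = a then t n else if i = b then w else if i = d then - w else 0)"
    have "u $ i * u $ j \<in> I" for i j
      using elim ww y r by (auto simp: u_def mult.commute)
    then have "outer u \<in> psd_mats_rank_le 1 I" by (rule outer_in_psd_rank_one)
    then have "rank (entrywise f (outer u)) \<le> 1"
      using rank by (auto simp: sym_mats_rank_le_def)
    from rank_le_one_minor[OF this, of a a b d]
    have "f (t n * t n) * f (- y) = f (t n * - w) * f (t n * w)"
      using ne ww by (simp add: entrywise_def outer_def u_def mult.commute)
    moreover have "f (t n * t n) = c * (t n * t n) ^ N" "f (t n * w) = c * (t n * w) ^ N"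
      using elim t(2)[of n] ww by (auto intro!: nonneg)
    ultimately have "c * t n ^ N * (t n ^ N * f (- y)) = c * t n ^ N * (w ^ N * f (t n * - w))"
      by (simp add: power_mult_distrib ac_simps)
    then have "t n ^ N * f (- y) = w ^ N * f (t n * - w)"
      using \<open>c \<noteq> 0\<close> t(3)[of n] by auto
    then show ?case using t(3)[of n] by (simp add: eq_divide_eq mult.commute)
  qed
  then have lim: "(\<lambda>n. w ^ N * (f (t n * - w) / t n ^ N)) \<longlonglongrightarrow> f (- y)"
    by (intro tendsto_eventually) (auto elim!: eventually_mono)
  have "(\<lambda>n. w ^ N * (f (t n * - w) / t n ^ N)) \<longlonglongrightarrow> w ^ N * (0 + c * (- w) ^ N)"
  proof (intro tendsto_mult tendsto_const)
    have "(\<lambda>n. (f (t n * - w) - c * (t n * - w) ^ N) / t n ^ N + c * (- w) ^ N) \<longlonglongrightarrow> 0 + c * (- w) ^ N"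
      using t in_I[OF tw[of "- w"]]
      by (intro tendsto_add tendsto_const peano_small_along_sequence[OF small]) auto
    moreover have "(f (t n * - w) - c * (t n * - w) ^ N) / t n ^ N + c * (- w) ^ N = f (t n * - w) / t n ^ N" for n
      unfolding power_mult_distrib using t(3)[of n] by (auto simp: diff_divide_distrib)
    ultimately show "(\<lambda>n. f (t n * - w) / t n ^ N) \<longlonglongrightarrow> 0 + c * (- w) ^ N" by simp
  qed
  from LIMSEQ_unique[OF lim this] have "f (- y) = w ^ N * (c * (- w) ^ N)" by simp
  also have "\<dots> = c * (w * - w) ^ N" by (simp only: power_mult_distrib) simp
  finally show ?thesis using ww by simp
qed

text \<open>
  The vector \<open>z\<close> is in the kernel of \<open>f[u u^T]\<close>, and \<open>f = p\<close> at all products of coordinates except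
  \<open>u\<^sub>b u\<^sub>d\<close>, where they differ by \<open>\<delta>\<close>. The rows of \<open>J\<close> say that the polynomial \<open>Q\<close> vanishes at the
  coordinates in \<open>J\<close>. Since \<open>Q\<close> has one term more than \<open>J\<close> has elements, it is a multiple \<open>s A\<close> of
  the polynomial \<open>A\<close> with the same exponents and leading coefficient \<open>1\<close> that vanishes there, and the other two rows compare \<open>s A(u\<^sub>b)\<close> and \<open>s A(u\<^sub>d)\<close> with
  \<open>\<delta> z\<close>. Pairing \<open>z\<close> with the values of \<open>A\<close> at the coordinates gives a third relation, and
  eliminating \<open>z\<close> gives the identity.
\<close>
lemma sign_defect_identity:
  fixes u z :: "real^'n" and m :: "'n \<Rightarrow> nat"
  assumes bd: "b \<noteq> d" "b \<notin> J" "d \<notin> J" and N: "N = degree p"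
    and m: "bij_betw m J ({i. coeff p i \<noteq> 0} - {N})" and p: "p \<noteq> 0"
    and \<beta>1: "\<And>i l. i \<in> J \<Longrightarrow> l \<in> J \<Longrightarrow> (\<Sum>j\<in>J. \<beta> i j * u $ j ^ m l) = (if i = l then 1 else 0)"
    and \<beta>2: "\<And>j l. j \<in> J \<Longrightarrow> l \<in> J \<Longrightarrow> (\<Sum>i\<in>J. u $ j ^ m i * \<beta> i l) = (if j = l then 1 else 0)"
    and z: "z \<noteq> 0" "\<And>i. i \<notin> J \<union> {b, d} \<Longrightarrow> z $ i = 0"
    and \<tau>: "\<And>i. \<tau> i = (\<Sum>l\<in>J. u $ l ^ N * \<beta> i l)"
    and A: "\<And>x. A x = x ^ N - (\<Sum>i\<in>J. \<tau> i * x ^ m i)"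
    and Q: "\<And>x. Q x = (\<Sum>i | coeff p i \<noteq> 0. coeff p i * power_functional u i z * x ^ i)"
    and QJ: "\<And>j. j \<in> J \<Longrightarrow> Q (u $ j) = 0"
    and Qb: "Q (u $ b) = - \<delta> * z $ d" and Qd: "Q (u $ d) = - \<delta> * z $ b" and \<delta>: "\<delta> \<noteq> 0"
  shows "\<delta> * (1 / coeff p N + (\<Sum>i\<in>J. (\<tau> i)\<^sup>2 / coeff p (m i))) = - 2 * A (u $ b) * A (u $ d)"
    and "\<And>j. j \<in> J \<Longrightarrow> A (u $ j) = 0"
proof -
  define \<phi> where "\<phi> i = power_functional u i z" for i
  define s where "s = coeff p N * \<phi> N"
  have c: "coeff p N \<noteq> 0" using p N by simp
  have cm: "coeff p (m i) \<noteq> 0" if "i \<in> J" for i using m that by (auto simp: bij_betw_def)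
  have Q': "Q x = s * x ^ N + (\<Sum>i\<in>J. coeff p (m i) * \<phi> (m i) * x ^ m i)" for x
    unfolding Q s_def \<phi>_def using c
    by (subst sum.remove[of _ N]) (auto simp: finite_coeff_support sum.reindex_bij_betw[OF m, symmetric])
  show AJ: "A (u $ j) = 0" if j: "j \<in> J" for j
  proof -
    have "(\<Sum>i\<in>J. \<tau> i * u $ j ^ m i) = (\<Sum>l\<in>J. u $ l ^ N * (\<Sum>i\<in>J. u $ j ^ m i * \<beta> i l))"
      unfolding \<tau> sum_distrib_left sum_distrib_right by (subst sum.swap) (simp add: ac_simps)
    also have "\<dots> = (\<Sum>l\<in>J. if l = j then u $ j ^ N else 0)"
      by (rule sum.cong) (use j in \<open>auto simp: \<beta>2\<close>)
    also have "\<dots> = u $ j ^ N" using j by simp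
    finally show ?thesis by (simp add: A)
  qed
  \<comment> \<open>apply the inverse matrix \<open>\<beta>\<close> to the equations \<open>Q (u $ j) = 0\<close>\<close>
  have coef: "coeff p (m l) * \<phi> (m l) = - s * \<tau> l" if l: "l \<in> J" for l
  proof -
    have "0 = (\<Sum>j\<in>J. \<beta> l j * Q (u $ j))" by (simp add: QJ)
    also have "\<dots> = s * \<tau> l + (\<Sum>i\<in>J. coeff p (m i) * \<phi> (m i) * (\<Sum>j\<in>J. \<beta> l j * u $ j ^ m i))"
      unfolding Q' \<tau> distrib_left sum.distrib sum_distrib_left
      by (subst sum.swap) (simp add: ac_simps)
    also have "(\<Sum>i\<in>J. coeff p (m i) * \<phi> (m i) * (\<Sum>j\<in>J. \<beta> l j * u $ j ^ m i))
        = (\<Sum>i\<in>J. if i = l then coeff p (m l) * \<phi> (m l) else 0)"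
      by (rule sum.cong) (use l in \<open>auto simp: \<beta>1\<close>)
    also have "\<dots> = coeff p (m l) * \<phi> (m l)" using l by simp
    finally show ?thesis by linarith
  qed
  have QA: "Q x = s * A x" for x
  proof -
    have "(\<Sum>i\<in>J. coeff p (m i) * \<phi> (m i) * x ^ m i) = (\<Sum>i\<in>J. - s * (\<tau> i * x ^ m i))"
      by (rule sum.cong) (simp_all add: coef)
    then show ?thesis
      unfolding Q' A by (simp add: sum_distrib_left[symmetric] sum_negf right_diff_distrib)
  qed
  have sum_P: "(\<Sum>a\<in>UNIV. z $ a * h a) = (\<Sum>j\<in>J. z $ j * h j) + z $ b * h b + z $ d * h d" for h
  proof -
    have "(\<Sum>a\<in>UNIV. z $ a * h a) = (\<Sum>a\<in>J \<union> {b, d}. z $ a * h a)"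
      by (rule sum.mono_neutral_right) (use z(2) in auto)
    also have "\<dots> = (\<Sum>j\<in>J. z $ j * h j) + (\<Sum>a\<in>{b, d}. z $ a * h a)"
      by (rule sum.union_disjoint) (use bd in auto)
    finally show ?thesis using bd by simp
  qed
  have "\<phi> N - (\<Sum>i\<in>J. \<tau> i * \<phi> (m i)) = (\<Sum>a\<in>UNIV. z $ a * A (u $ a))"
  proof -
    have "(\<Sum>i\<in>J. \<tau> i * \<phi> (m i)) = (\<Sum>a\<in>UNIV. \<Sum>i\<in>J. z $ a * (\<tau> i * u $ a ^ m i))"
      unfolding \<phi>_def power_functional_def sum_distrib_left by (subst sum.swap) (simp add: ac_simps)
    then show ?thesis
      unfolding A right_diff_distrib sum_subtractf sum_distrib_left
      by (simp add: \<phi>_def power_functional_def)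
  qed
  also have "\<dots> = z $ b * A (u $ b) + z $ d * A (u $ d)"
    unfolding sum_P by (simp add: AJ)
  finally have pairing: "\<phi> N - (\<Sum>i\<in>J. \<tau> i * \<phi> (m i)) = z $ b * A (u $ b) + z $ d * A (u $ d)" .
  define D where "D = 1 / coeff p N + (\<Sum>i\<in>J. (\<tau> i)\<^sup>2 / coeff p (m i))"
  have "s * D = \<phi> N - (\<Sum>i\<in>J. \<tau> i * \<phi> (m i))"
  proof -
    have "(\<Sum>i\<in>J. \<tau> i * \<phi> (m i)) = (\<Sum>i\<in>J. - s * ((\<tau> i)\<^sup>2 / coeff p (m i)))"
    proof (rule sum.cong)
      fix i assume i: "i \<in> J"
      have "\<phi> (m i) = - s * \<tau> i / coeff p (m i)"
        using coef[OF i] cm[OF i] by (simp add: field_simps)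
      then show "\<tau> i * \<phi> (m i) = - s * ((\<tau> i)\<^sup>2 / coeff p (m i))"
        by (simp add: power2_eq_square)
    qed simp
    also have "\<dots> = - s * (\<Sum>i\<in>J. (\<tau> i)\<^sup>2 / coeff p (m i))"
      by (rule sum_distrib_left[symmetric])
    finally show ?thesis using c by (simp add: D_def s_def distrib_left)
  qed
  then have sD: "s * D = z $ b * A (u $ b) + z $ d * A (u $ d)" using pairing by simp
  have sA: "s * A (u $ b) = - \<delta> * z $ d" "s * A (u $ d) = - \<delta> * z $ b"
    using Qb Qd QA by simp_all
  \<comment> \<open>if \<open>s = 0\<close>, all power functionals with exponents \<open>m i\<close> annihilate \<open>z\<close>, and Vandermonde gives \<open>z = 0\<close>\<close>
  have "s \<noteq> 0"
  proof
    assume s: "s = 0"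
    then have zbd: "z $ b = 0" "z $ d = 0" using sA \<delta> by auto
    have \<phi>0: "(\<Sum>l\<in>J. z $ l * u $ l ^ m i) = 0" if "i \<in> J" for i
    proof -
      have "\<phi> (m i) = 0" using coef[OF that] cm[OF that] s by simp
      then show ?thesis unfolding \<phi>_def power_functional_def sum_P zbd by simp
    qed
    have "z $ j = 0" if j: "j \<in> J" for j
    proof -
      have "0 = (\<Sum>i\<in>J. (\<Sum>l\<in>J. z $ l * u $ l ^ m i) * \<beta> i j)" by (simp add: \<phi>0)
      also have "\<dots> = (\<Sum>l\<in>J. z $ l * (\<Sum>i\<in>J. u $ l ^ m i * \<beta> i j))"
        unfolding sum_distrib_left sum_distrib_right by (subst sum.swap) (simp add: ac_simps)
      also have "\<dots> = (\<Sum>l\<in>J. if l = j then z $ j else 0)"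
        by (rule sum.cong) (use j in \<open>auto simp: \<beta>2\<close>)
      finally show ?thesis using j by simp
    qed
    then have "z $ i = 0" for i using z(2)[of i] zbd by blast
    then show False using z(1) by (simp add: vec_eq_iff)
  qed
  have "s * (\<delta> * D) = \<delta> * (s * D)" by simp
  also have "\<dots> = - (s * A (u $ d)) * A (u $ b) - (s * A (u $ b)) * A (u $ d)"
    unfolding sA sD by (simp add: algebra_simps)
  also have "\<dots> = s * (- 2 * A (u $ b) * A (u $ d))" by (simp add: algebra_simps)
  finally have "\<delta> * D = - 2 * A (u $ b) * A (u $ d)" using \<open>s \<noteq> 0\<close> mult_left_cancel by blast
  then show "\<delta> * (1 / coeff p N + (\<Sum>i\<in>J. (\<tau> i)\<^sup>2 / coeff p (m i))) = - 2 * A (u $ b) * A (u $ d)"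
    by (simp add: D_def)
qed

text \<open>
  The near coordinates and the factor \<open>D\<close> of the identity stay fixed while \<open>w\<close> varies, so \<open>A(w) A(- y / w)\<close>
  is constant on an interval. As a polynomial identity after multiplication by \<open>w^N\<close>, it may be
  evaluated at the near coordinates as well, which do not lie in that interval and at which \<open>A\<close>
  vanishes.
\<close>
lemma sign_defect_vanishes:
  fixes f :: "real \<Rightarrow> real"
  assumes J: "card J + 1 = k" "J \<noteq> {}" "(J :: 'n set) \<inter> {b, d} = {}" "b \<noteq> d"
    and m: "bij_betw m J ({i. coeff p i \<noteq> 0} - {degree p})" and p: "p \<noteq> 0"
    and rank: "entrywise f \<in> (psd_mats_rank_le 1 I :: (real^'n^'n) set) \<rightarrow> sym_mats_rank_le k UNIV"
    and nonneg: "\<And>x. x \<in> I \<Longrightarrow> 0 \<le> x \<Longrightarrow> f x = poly p x"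
    and near: "0 < e" "\<And>x. - e < x \<Longrightarrow> x < 0 \<Longrightarrow> x \<in> I \<Longrightarrow> f x = poly p x"
    and y: "0 < y" "y < r" and r: "{- r<..<r} \<subseteq> I"
  shows "f (- y) = poly p (- y)"
proof (rule ccontr)
  assume "f (- y) \<noteq> poly p (- y)"
  define \<delta> where "\<delta> = f (- y) - poly p (- y)"
  have \<delta>: "\<delta> \<noteq> 0" using \<open>f (- y) \<noteq> poly p (- y)\<close> by (simp add: \<delta>_def)
  define N where "N = degree p"
  have mN: "m i < N" if "i \<in> J" for i
  proof -
    have "coeff p (m i) \<noteq> 0" "m i \<noteq> N" using m that by (auto simp: bij_betw_def N_def)
    then show ?thesis using le_degree[of p "m i"] by (simp add: N_def)
  qed
  obtain v :: "'n \<Rightarrow> real" and \<alpha> :: "'n \<Rightarrow> 'n \<Rightarrow> real" where v: "\<And>j. 0 < v j"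
    and dual1: "\<forall>i\<in>J. \<forall>l\<in>J. (\<Sum>j\<in>J. \<alpha> i j * v j ^ m l) = (if i = l then 1 else 0)"
    and dual2: "\<forall>j\<in>J. \<forall>l\<in>J. (\<Sum>i\<in>J. v j ^ m i * \<alpha> i l) = (if j = l then 1 else 0)"
    using generalized_vandermonde_inverse[OF bij_betw_imp_inj_on[OF m]] by auto
  \<comment> \<open>bounds the near coordinates so that their products with \<open>y / w \<le> sqrt y\<close> stay below \<open>e\<close>\<close>
  define C where "C = min (sqrt y) (e / (2 * sqrt y))"
  have C: "0 < C" "C \<le> sqrt y" "C * sqrt y < e"
  proof -
    have sy: "0 < sqrt y" using y by simp
    show "0 < C" using sy near(1) by (simp add: C_def)
    show "C \<le> sqrt y" by (simp add: C_def)
    have "C * sqrt y \<le> e / (2 * sqrt y) * sqrt y"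
      using sy by (intro mult_right_mono) (auto simp: C_def)
    also have "\<dots> < e" using sy near(1) by simp
    finally show "C * sqrt y < e" .
  qed
  define s where "s = C / (1 + (\<Sum>j\<in>J. v j))"
  have "0 \<le> (\<Sum>j\<in>J. v j)" using v by (intro sum_nonneg) (auto intro: less_imp_le)
  then have s: "0 < s" "\<And>j. j \<in> J \<Longrightarrow> s * v j \<le> C"
  proof -
    assume V: "0 \<le> (\<Sum>j\<in>J. v j)"
    show "0 < s" using C(1) V by (simp add: s_def)
    fix j assume "j \<in> J"
    then have "v j \<le> 1 + (\<Sum>j\<in>J. v j)"
      using member_le_sum[of j J v] v by (force intro: less_imp_le)
    then have "C * v j \<le> C * (1 + (\<Sum>j\<in>J. v j))" using C(1) by (intro mult_left_mono) auto
    then show "s * v j \<le> C" using V by (simp add: s_def divide_le_eq)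
  qed
  define x where "x j = s * v j" for j
  have x: "0 < x j" for j using s v by (simp add: x_def)
  define \<beta> where "\<beta> i j = \<alpha> i j / s ^ m i" for i j
  have \<beta>1: "(\<Sum>j\<in>J. \<beta> i j * x j ^ m l) = (if i = l then 1 else 0)" if "i \<in> J" "l \<in> J" for i l
  proof -
    have "(\<Sum>j\<in>J. \<beta> i j * x j ^ m l) = s ^ m l / s ^ m i * (\<Sum>j\<in>J. \<alpha> i j * v j ^ m l)"
      by (simp add: \<beta>_def x_def sum_distrib_left power_mult_distrib ac_simps)
    also have "\<dots> = (if i = l then 1 else 0)" using dual1 that s(1) by simp
    finally show ?thesis .
  qed
  have \<beta>2: "(\<Sum>i\<in>J. x j ^ m i * \<beta> i l) = (if j = l then 1 else 0)" if "j \<in> J" "l \<in> J" for j l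
  proof -
    have "(\<Sum>i\<in>J. x j ^ m i * \<beta> i l) = (\<Sum>i\<in>J. v j ^ m i * \<alpha> i l)"
      using s(1) by (intro sum.cong) (simp_all add: \<beta>_def x_def power_mult_distrib)
    then show ?thesis using dual2 that by simp
  qed
  define \<tau> where "\<tau> i = (\<Sum>l\<in>J. x l ^ N * \<beta> i l)" for i
  define A where "A t = t ^ N - (\<Sum>i\<in>J. \<tau> i * t ^ m i)" for t
  define D where "D = 1 / coeff p N + (\<Sum>i\<in>J. (\<tau> i)\<^sup>2 / coeff p (m i))"
  \<comment> \<open>for these \<open>w\<close> both \<open>w^2\<close> and \<open>(y / w)^2\<close> stay in the interval, and \<open>y / w \<le> sqrt y\<close>\<close>
  define W where "W = {sqrt y..<sqrt r}"
  have main: "\<delta> * D = - 2 * A w * A (- y / w) \<and> (\<forall>j\<in>J. A (x j) = 0)" if w: "w \<in> W" for w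
  proof -
    have wW: "sqrt y \<le> w" "w < sqrt r" using w by (simp_all add: W_def)
    have "0 < sqrt y" using y by simp
    then have "0 < w" using wW(1) by (rule less_le_trans)
    note w0 = this wW
    have yw: "y / w \<le> sqrt y" "0 < y / w"
    proof -
      have "y = sqrt y * sqrt y" using y by simp
      also have "\<dots> \<le> sqrt y * w" using w0 y by (intro mult_left_mono) auto
      finally show "y / w \<le> sqrt y" using w0 by (simp add: divide_le_eq)
      show "0 < y / w" using y w0 by simp
    qed
    have sr: "sqrt y < sqrt r" using y by simp
    define u :: "real^'n" where
      "u = (\<chi> i. if i \<in> J then x i else if i = b then w else if i = d then - y / w else 0)"
    have uJ: "u $ j = x j" if "j \<in> J" for j using that by (simp add: u_def)
    have ub: "u $ b = w" and ud: "u $ d = - y / w" using J by (auto simp: u_def)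
    have u0: "u $ i = 0" if "i \<notin> J \<union> {b, d}" for i using that by (simp add: u_def)
    have xC: "x j \<le> C" if "j \<in> J" for j using s(2)[OF that] by (simp add: x_def)
    have u_bound: "\<bar>u $ i\<bar> < sqrt r" for i
    proof -
      consider "i \<in> J" | "i = b" | "i = d" | "i \<notin> J \<union> {b, d}" by blast
      then show ?thesis
      proof cases
        case 1
        then show ?thesis using xC[OF 1] x[of i] C(2) sr unfolding uJ[OF 1] by linarith
      next
        case 2
        then show ?thesis using w0 by (simp add: ub)
      next
        case 3
        have "\<bar>- y / w\<bar> = y / w" using y w0 by simp
        then show ?thesis using yw sr unfolding 3 ud by linarith
      next
        case 4
        then show ?thesis using y by (simp add: u0)
      qed
    qed
    have uI: "u $ i * u $ j \<in> I" for i j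
    proof -
      have "\<bar>u $ i * u $ j\<bar> < sqrt r * sqrt r"
        unfolding abs_mult using u_bound by (intro mult_strict_mono') auto
      then have "\<bar>u $ i * u $ j\<bar> < r" using y by simp
      then show ?thesis using r by (auto simp: abs_less_iff)
    qed
    have f_u: "f (u $ i * u $ j) = poly p (u $ i * u $ j)
        + (if i = b \<and> j = d \<or> i = d \<and> j = b then \<delta> else 0)" for i j
    proof -
      have wd: "w * (y / w) = y" using w0 by simp
      have small_neg: "f (- (x l * (y / w))) = poly p (- (x l * (y / w)))" if "l \<in> J" for l
      proof (rule near(2))
        have "x l * (y / w) \<le> C * sqrt y"
          using xC[OF that] yw x[of l] C(1) by (intro mult_mono) auto
        then show "- e < - (x l * (y / w))" using C(3) by simp
        show "- (x l * (y / w)) < 0" using mult_pos_pos[OF x[of l] yw(2)] by simp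
        show "- (x l * (y / w)) \<in> I" using uI[of l d] that by (simp add: uJ ud)
      qed
      consider "i = b \<and> j = d \<or> i = d \<and> j = b" | "i \<in> J" "j = d" | "i = d" "j \<in> J"
        | "0 \<le> u $ i * u $ j" "\<not> (i = b \<and> j = d \<or> i = d \<and> j = b)"
      proof -
        have sgn: "0 \<le> u $ l" if "l \<noteq> d" for l
          using that x[of l] w0 by (auto simp: u_def)
        have "u $ d \<le> 0" using yw by (simp add: ud)
        show ?thesis
        proof (cases "i = d"; cases "j = d")
          assume "i = d" "j = d"
          then show ?thesis using that(4) J \<open>u $ d \<le> 0\<close> by (simp add: mult_nonpos_nonpos)
        next
          assume "i = d" "j \<noteq> d"
          then show ?thesis using that u0[of j] J by force
        next
          assume "i \<noteq> d" "j = d"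
          then show ?thesis using that u0[of i] J by force
        next
          assume "i \<noteq> d" "j \<noteq> d"
          then show ?thesis using that(4) sgn by simp
        qed
      qed
      then show ?thesis
      proof cases
        case 1
        then have "u $ i * u $ j = - y" using ub ud wd by auto
        then show ?thesis using 1 by (simp add: \<delta>_def)
      next
        case 2
        moreover have "i \<noteq> b" "i \<noteq> d" using 2 J by auto
        ultimately show ?thesis using small_neg[of i] by (simp add: uJ ud)
      next
        case 3
        moreover have "j \<noteq> b" "j \<noteq> d" using 3 J by auto
        ultimately show ?thesis using small_neg[of j] by (simp add: uJ ud mult.commute)
      next
        case 4
        then show ?thesis using nonneg[OF uI 4(1)] by auto
      qed
    qed
    let ?P = "J \<union> {b, d}"
    have "card ?P = card J + card {b, d}" using J(3) by (intro card_Un_disjoint) auto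
    then have cardP: "k < card ?P" using J by simp
    have "outer u \<in> psd_mats_rank_le 1 I" using uI by (rule outer_in_psd_rank_one)
    then have "rank (entrywise f (outer u)) \<le> k"
      using rank by (auto simp: sym_mats_rank_le_def)
    then obtain z where z: "z \<noteq> 0" "\<And>i. i \<notin> ?P \<Longrightarrow> z $ i = 0" "entrywise f (outer u) *v z = 0"
      using matrix_kernel_on_indices[of "entrywise f (outer u)" ?P] cardP by auto
    define Q where "Q t = (\<Sum>i | coeff p i \<noteq> 0. coeff p i * power_functional u i z * t ^ i)" for t
    have row: "Q (u $ a) + (if a = b then \<delta> * z $ d else if a = d then \<delta> * z $ b else 0) = 0" for a
    proof -
      have "0 = (entrywise f (outer u) *v z) $ a" using z(3) by simp
      also have "\<dots> = (entrywise (poly p) (outer u) *v z) $ a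
          + (\<Sum>j\<in>UNIV. (if a = b \<and> j = d \<or> a = d \<and> j = b then \<delta> else 0) * z $ j)"
        by (simp add: matrix_vector_mult_def entrywise_def outer_def f_u distrib_right sum.distrib)
      also have "(entrywise (poly p) (outer u) *v z) $ a = Q (u $ a)"
        by (subst entrywise_poly_outer_mult[where p = p]) (simp_all add: Q_def)
      also have "(\<Sum>j\<in>UNIV. (if a = b \<and> j = d \<or> a = d \<and> j = b then \<delta> else 0) * z $ j)
          = (\<Sum>j\<in>UNIV. if j = (if a = b then d else b) then
              (if a = b then \<delta> * z $ d else if a = d then \<delta> * z $ b else 0) else 0)"
        by (rule sum.cong) (use J(4) in auto)
      also have "\<dots> = (if a = b then \<delta> * z $ d else if a = d then \<delta> * z $ b else 0)"
        by simp
      finally show ?thesis by simp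
    qed
    have QJ: "Q (u $ j) = 0" if "j \<in> J" for j
    proof -
      have "j \<noteq> b" "j \<noteq> d" using that J by auto
      then show ?thesis using row[of j] by simp
    qed
    have Qb: "Q (u $ b) = - \<delta> * z $ d" and Qd: "Q (u $ d) = - \<delta> * z $ b"
      using row[of b] row[of d] J(4) by (simp_all add: eq_neg_iff_add_eq_0)
    have u\<beta>1: "(\<Sum>j\<in>J. \<beta> i j * u $ j ^ m l) = (if i = l then 1 else 0)" if "i \<in> J" "l \<in> J" for i l
      using \<beta>1[OF that] by (simp add: uJ)
    have u\<beta>2: "(\<Sum>i\<in>J. u $ j ^ m i * \<beta> i l) = (if j = l then 1 else 0)" if "j \<in> J" "l \<in> J" for j l
      using \<beta>2[OF that] that by (simp add: uJ)
    have u\<tau>: "\<tau> i = (\<Sum>l\<in>J. u $ l ^ N * \<beta> i l)" for i by (simp add: \<tau>_def uJ)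
    have bJ: "b \<notin> J" "d \<notin> J" using J(3) by auto
    note id = sign_defect_identity[where u = u and z = z and J = J and b = b and d = d and p = p
        and N = N and m = m and \<beta> = \<beta> and \<tau> = \<tau> and A = A and Q = Q and \<delta> = \<delta>,
        OF J(4) bJ N_def m[folded N_def] p u\<beta>1 u\<beta>2 z(1,2) u\<tau> A_def Q_def QJ Qb Qd \<delta>]
    show ?thesis using id uJ ub ud by (simp add: D_def)
  qed
  have "sqrt y < sqrt r" using y by simp
  then have infW: "infinite W" unfolding W_def by (rule infinite_Ico)
  have "W \<noteq> {}" using infW by auto
  then have Ax: "A (x j) = 0" if "j \<in> J" for j using main that by blast
  define a where "a = monom 1 N - (\<Sum>i\<in>J. monom (\<tau> i) (m i))"
  \<comment> \<open>the polynomial \<open>t^N A(- y / t)\<close>; its constant term comes from the leading term of \<open>A\<close>\<close>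
  define a' where "a' = [:(- y) ^ N:] - (\<Sum>i\<in>J. monom (\<tau> i * (- y) ^ m i) (N - m i))"
  have a: "poly a t = A t" for t
    by (simp add: a_def A_def poly_monom poly_sum)
  have a': "poly a' t = t ^ N * A (- y / t)" if "t \<noteq> 0" for t
  proof -
    have e1: "t ^ N * (\<tau> i * (- y / t) ^ m i) = \<tau> i * (- y) ^ m i * t ^ (N - m i)" if "i \<in> J" for i
      using mN[OF that] \<open>t \<noteq> 0\<close> unfolding power_divide by (simp add: power_diff less_imp_le)
    have e2: "t ^ N * (- y / t) ^ N = (- y) ^ N"
      using \<open>t \<noteq> 0\<close> by (simp flip: power_mult_distrib)
    have "poly a' t = (- y) ^ N - (\<Sum>i\<in>J. \<tau> i * (- y) ^ m i * t ^ (N - m i))"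
      by (simp add: a'_def poly_monom poly_sum)
    also have "(\<Sum>i\<in>J. \<tau> i * (- y) ^ m i * t ^ (N - m i)) = (\<Sum>i\<in>J. t ^ N * (\<tau> i * (- y / t) ^ m i))"
      by (rule sum.cong) (simp_all only: e1)
    finally show ?thesis
      unfolding A_def right_diff_distrib sum_distrib_left e2 .
  qed
  let ?g = "smult 2 (a * a') + monom (\<delta> * D) N"
  have "poly ?g t = 0" if "t \<in> W" for t
  proof -
    have "t \<noteq> 0" using that y by (auto simp: W_def)
    have "poly ?g t = t ^ N * (2 * A t * A (- y / t) + \<delta> * D)"
      using \<open>t \<noteq> 0\<close> by (simp add: a a' poly_monom algebra_simps)
    then show ?thesis using main[OF that] by simp
  qed
  then have "W \<subseteq> {t. poly ?g t = 0}" by blast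
  then have g0: "?g = 0" using infW poly_roots_finite infinite_super by blast
  obtain j where j: "j \<in> J" using J(2) by blast
  have "poly ?g (x j) = \<delta> * D * x j ^ N" using Ax[OF j] by (simp add: a poly_monom)
  then have D: "\<delta> * D = 0" using g0 x[of j] by simp
  have "a * a' = 0" using g0 D by simp
  moreover have "a \<noteq> 0"
  proof -
    have "coeff a N = 1"
      using mN by (simp add: a_def coeff_sum)
        (rule sum.neutral, auto)
    then show ?thesis by auto
  qed
  moreover have "a' \<noteq> 0"
  proof -
    have "(\<Sum>i\<in>J. \<tau> i * (- y) ^ m i * 0 ^ (N - m i)) = 0"
      by (rule sum.neutral) (auto dest: mN simp: power_0_left)
    then have "poly a' 0 = (- y) ^ N"
      by (simp add: a'_def poly_sum poly_monom)
    then show ?thesis using y by auto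
  qed
  ultimately show False by simp
qed

text \<open>
  A single monomial is settled by a \<open>2 \<times> 2\<close> minor. With two or more
  terms, the comparison of magnitudes for \<open>p\<close> without its leading term \<open>c x^N\<close> leaves the values
  \<open>0\<close> and \<open>- 2 c x^N\<close> for \<open>f x - p x\<close>; the second one is excluded near \<open>0\<close> by the size of the
  remainder, and elsewhere by \<open>sign_defect_vanishes\<close>.
\<close>
lemma rank_forces_taylor_polynomial_two_sided:
  fixes f :: "real \<Rightarrow> real"
  assumes small: "peano_small (degree p) I (\<lambda>x. f x - poly p x)"
    and I: "0 \<in> I" "\<And>x. x \<in> I \<Longrightarrow> \<exists>r>\<bar>x\<bar>. {- r<..<r} \<subseteq> I"
    and rank: "entrywise f \<in> (psd_mats_rank_le 1 I :: (real^'n^'n) set) \<rightarrow> sym_mats_rank_le k UNIV"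
    and k: "card {i. coeff p i \<noteq> 0} = k" "1 \<le> k" "k < CARD('n::finite)" "3 \<le> CARD('n)"
    and x: "x \<in> I"
  shows "f x = poly p x"
proof -
  obtain r0 where r0: "0 < r0" "{- r0<..<r0} \<subseteq> I" using I(2)[OF I(1)] by auto
  then have r0': "{0..<r0} \<subseteq> I" by auto
  have sym: "- y \<in> I" if "y \<in> I" for y
  proof -
    obtain r where "\<bar>y\<bar> < r" "{- r<..<r} \<subseteq> I" using I(2)[OF \<open>y \<in> I\<close>] by blast
    then show ?thesis by (auto simp: abs_less_iff)
  qed
  note nonneg = rank_forces_taylor_polynomial_nonneg[OF small r0(1) r0' rank k(1,3)]
  show ?thesis
  proof (cases "0 \<le> x")
    case True
    then show ?thesis using nonneg x by blast
  next
    case False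
    define y where "y = - x"
    have y: "0 < y" "y \<in> I" "- y \<in> I" using False x sym by (auto simp: y_def)
    define N where "N = degree p"
    define c where "c = coeff p N"
    have "p \<noteq> 0" using k(1,2) by auto
    then have c: "c \<noteq> 0" by (simp add: c_def N_def)
    define S where "S = {i. coeff p i \<noteq> 0} - {N}"
    have cardS: "card S + 1 = k"
      using c k(1,2) by (simp add: S_def c_def card_Diff_singleton finite_coeff_support)
    have "f (- y) = poly p (- y)"
    proof (cases "k = 1")
      case True
      have "finite S" by (simp add: S_def finite_coeff_support)
      then have "S = {}" using True cardS by simp
      then have "{i. coeff p i \<noteq> 0} = {N}" using c by (auto simp: S_def c_def)
      then have p: "poly p t = c * t ^ N" for t by (simp add: poly_eq_sum_support c_def)
      show ?thesis
        unfolding p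
        by (rule monomial_case_negative[OF _ c rank[unfolded True] k(4) _ r0])
           (use small nonneg y in \<open>auto simp: p N_def[symmetric]\<close>)
    next
      case False
      then have "S \<noteq> {}" using cardS by auto
      define q where "q = p - monom c N"
      have coeff_q: "coeff q i = (if i = N then 0 else coeff p i)" for i
        by (simp add: q_def c_def)
      have Sq: "{i. coeff q i \<noteq> 0} = S" by (auto simp: coeff_q S_def)
      have "q \<noteq> 0" using \<open>S \<noteq> {}\<close> Sq by auto
      then have "coeff q (degree q) \<noteq> 0" by simp
      then have "degree q \<noteq> N" "coeff p (degree q) \<noteq> 0" by (auto simp: coeff_q split: if_splits)
      then have deg: "degree q < N" using le_degree[of p "degree q"] by (simp add: N_def)
      have "p = q + monom c N" by (simp add: q_def)
      then have small_q: "peano_small (degree q) I (\<lambda>x. f x - poly q x)"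
        using peano_small_drop_leading_term[OF small] deg by (simp add: N_def)
      have poly_q: "poly q t = poly p t - c * t ^ N" for t by (simp add: q_def poly_monom)
      have mag: "\<bar>(f t - poly p t) + c * t ^ N\<bar> = \<bar>c * t ^ N\<bar>" if "t \<in> I" "t < 0" for t
      proof -
        have "\<bar>f (- (- t)) - poly q (- (- t))\<bar> = \<bar>f (- t) - poly q (- t)\<bar>"
          by (rule rank_forces_equal_magnitudes[OF small_q r0 rank _ k(3)])
             (use cardS Sq that sym in auto)
        moreover have "f (- t) = poly p (- t)" using nonneg sym that by simp
        ultimately show ?thesis by (simp add: poly_q abs_mult power_abs)
      qed
      have "0 < N" using deg by simp
      obtain e where e: "0 < e"
        "\<And>t. t \<in> I \<Longrightarrow> t \<noteq> 0 \<Longrightarrow> \<bar>t\<bar> < e \<Longrightarrow> \<bar>f t - poly p t\<bar> < \<bar>c\<bar> * \<bar>t\<bar> ^ N"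
        using peano_small_strict_bound[of N I "\<lambda>x. f x - poly p x" "\<bar>c\<bar>"] small c \<open>0 < N\<close>
        by (auto simp: N_def)
      have near: "f t = poly p t" if "- e < t" "t < 0" "t \<in> I" for t
      proof -
        have "\<bar>f t - poly p t\<bar> < \<bar>c * t ^ N\<bar>"
          using e(2)[of t] that by (simp add: abs_mult power_abs)
        then show ?thesis using mag[OF that(3,2)] by linarith
      qed
      obtain r where r: "y < r" "{- r<..<r} \<subseteq> I" using I(2)[OF y(2)] y(1) by auto
      have "card S + 2 \<le> CARD('n)" "finite S"
        using cardS k(3) by (auto simp: S_def finite_coeff_support)
      then obtain J B :: "'n set" and m where J: "J \<inter> B = {}" "card B = 2" and m: "bij_betw m J S"
        by (rule near_and_far_indices)
      obtain b d where B: "B = {b, d}" "b \<noteq> d" using J(2) by (auto simp: card_2_iff)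
      have cJ: "card J + 1 = k" using bij_betw_same_card[OF m] cardS by simp
      have "J \<noteq> {}" using m \<open>S \<noteq> {}\<close> by (auto simp: bij_betw_def)
      from sign_defect_vanishes[OF cJ this J(1)[unfolded B(1)] B(2) m[unfolded S_def N_def]
          \<open>p \<noteq> 0\<close> rank nonneg e(1) near y(1) r]
      show ?thesis .
    qed
    then show ?thesis by (simp add: y_def)
  qed
qed

section \<open>Polynomials act as required\<close>

lemma polynomial_gives_rank:
  assumes "polynomial_with_coeffs k I f"
  shows "entrywise f \<in> (psd_mats_rank_le 1 I :: (real^'n^'n) set) \<rightarrow> sym_mats_rank_le k UNIV"
proof
  fix A :: "real^'n^'n" assume A: "A \<in> psd_mats_rank_le 1 I"
  obtain p where p: "\<And>x. x \<in> I \<Longrightarrow> f x = poly p x" "card {i. coeff p i \<noteq> 0} = k"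
    using assms by (auto simp: polynomial_with_coeffs_def)
  obtain u where u: "A = outer u" using A by (rule psd_rank_one_is_outer)
  have "u $ i * u $ j \<in> I" for i j
    using A u by (auto simp: psd_mats_rank_le_def psd_mats_def sym_mats_def outer_def)
  then have "rank (entrywise f (outer u)) \<le> k"
    using entrywise_poly_outer_rank[of f u p] p by simp
  then show "entrywise f A \<in> sym_mats_rank_le k UNIV"
    by (simp add: u sym_mats_rank_le_def sym_mats_def transpose_entrywise_outer)
qed

lemma positive_polynomial_gives_psd:
  assumes "polynomial_with_pos_coeffs k I f"
  shows "entrywise f \<in> (psd_mats_rank_le 1 I :: (real^'n^'n) set) \<rightarrow> psd_mats_rank_le k UNIV"
proof
  fix A :: "real^'n^'n" assume A: "A \<in> psd_mats_rank_le 1 I"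
  obtain p where p: "\<And>x. x \<in> I \<Longrightarrow> f x = poly p x" "card {i. coeff p i \<noteq> 0} = k"
    and pos: "\<And>i. coeff p i \<noteq> 0 \<Longrightarrow> coeff p i > 0"
    using assms by (auto simp: polynomial_with_pos_coeffs_def)
  obtain u where u: "A = outer u" using A by (rule psd_rank_one_is_outer)
  have "u $ i * u $ j \<in> I" for i j
    using A u by (auto simp: psd_mats_rank_le_def psd_mats_def sym_mats_def outer_def)
  then have fp: "f (u $ i * u $ j) = poly p (u $ i * u $ j)" for i j using p(1) by blast
  have "0 \<le> x \<bullet> (entrywise f (outer u) *v x)" for x
    unfolding entrywise_poly_outer_form[where f = f, OF fp]
    using pos by (intro sum_nonneg) (auto simp: mult.assoc less_imp_le)
  moreover have "rank (entrywise f (outer u)) \<le> k"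
    using entrywise_poly_outer_rank[of f u p] p(2) fp by simp
  ultimately show "entrywise f A \<in> psd_mats_rank_le k UNIV"
    by (simp add: u psd_mats_rank_le_def psd_mats_def sym_mats_def transpose_entrywise_outer)
qed

section \<open>Taylor polynomials with a prescribed number of terms\<close>

definition taylor_poly :: "(nat \<Rightarrow> real) \<Rightarrow> nat \<Rightarrow> real poly" where
  "taylor_poly a N = (\<Sum>j\<le>N. monom (a j / fact j) j)"

lemma coeff_taylor_poly: "coeff (taylor_poly a N) i = (if i \<le> N then a i / fact i else 0)"
proof -
  have "coeff (taylor_poly a N) i = (\<Sum>j\<le>N. if j = i then a i / fact i else 0)"
    unfolding taylor_poly_def coeff_sum by (rule sum.cong) auto
  then show ?thesis by simp
qed

lemma degree_taylor_poly: "a N \<noteq> 0 \<Longrightarrow> degree (taylor_poly a N) = N"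
  by (intro antisym degree_le le_degree) (auto simp: coeff_taylor_poly)

lemma peano_small_taylor_poly:
  assumes "convex S" and "0 \<in> S" and "\<And>y. y \<in> S \<Longrightarrow> at y within S \<noteq> bot"
    and "\<forall>j\<le>N. has_nth_derivative j f S 0 (a j)" and "a N \<noteq> 0"
  shows "peano_small (degree (taylor_poly a N)) S (\<lambda>x. f x - poly (taylor_poly a N) x)"
  using peano_taylor[OF assms(1-4)]
  by (simp add: degree_taylor_poly[of a N, OF assms(5)]) (simp add: taylor_poly_def poly_sum poly_monom)

text \<open>
  The orders in \<open>M\<close> need not be the first ones with nonzero derivative, so the expansion is cut off
  at the least order \<open>N\<close> up to which there are \<open>k\<close> nonzero derivatives.
\<close>
lemma taylor_polynomial_with_k_terms:
  fixes f :: "real \<Rightarrow> real"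
  assumes S: "convex S" "0 \<in> S" "\<And>y. y \<in> S \<Longrightarrow> at y within S \<noteq> bot"
    and M: "finite M" "card M = k" "\<forall>m\<in>M. \<exists>D. has_nth_derivative m f S 0 D \<and> D \<noteq> 0" and "1 \<le> k"
  obtains p where "card {i. coeff p i \<noteq> 0} = k"
    and "peano_small (degree p) S (\<lambda>x. f x - poly p x)"
proof -
  have "M \<noteq> {}" using M(2) \<open>1 \<le> k\<close> by auto
  define L where "L = Max M"
  have "L \<in> M" using M(1) \<open>M \<noteq> {}\<close> by (simp add: L_def)
  then obtain D where D: "has_nth_derivative L f S 0 D" using M(3) by blast
  have "\<exists>E. has_nth_derivative j f S 0 E" if "j \<le> L" for j
    using has_nth_derivative_lower[OF D S(2) that] .
  then obtain a where a: "\<And>j. j \<le> L \<Longrightarrow> has_nth_derivative j f S 0 (a j)" by metis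
  define K where "K n = {j. j \<le> n \<and> a j \<noteq> 0}" for n
  have finK: "finite (K n)" for n by (simp add: K_def)
  have "M \<subseteq> K L"
  proof
    fix m assume m: "m \<in> M"
    then have "m \<le> L" using M(1) by (simp add: L_def)
    moreover obtain E where "has_nth_derivative m f S 0 E" "E \<noteq> 0" using M(3) m by blast
    ultimately show "m \<in> K L"
      using has_nth_derivative_unique[OF S(3) S(2) a[of m]] by (auto simp: K_def)
  qed
  then have kL: "k \<le> card (K L)" using M(2) finK card_mono by blast
  define N where "N = (LEAST n. k \<le> card (K n))"
  have kN: "k \<le> card (K N)" unfolding N_def using kL by (rule LeastI)
  have NL: "N \<le> L" unfolding N_def using kL by (rule Least_le)
  have before: "card (K n) < k" if "n < N" for n
    using not_less_Least[of n "\<lambda>n. k \<le> card (K n)"] that by (simp add: N_def)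
  have aN: "a N \<noteq> 0"
  proof
    assume "a N = 0"
    show False
    proof (cases N)
      case 0
      then have "K N = {}" using \<open>a N = 0\<close> by (auto simp: K_def intro: gr0I)
      then show False using kN \<open>1 \<le> k\<close> by simp
    next
      case (Suc n)
      then have "K N = K n" using \<open>a N = 0\<close> by (auto simp: K_def le_Suc_eq)
      then show False using kN before[of n] Suc by simp
    qed
  qed
  have "card (K N) \<le> k"
  proof (cases N)
    case 0
    then have "K N \<subseteq> {0}" by (auto simp: K_def)
    then have "card (K N) \<le> card {0::nat}" by (intro card_mono) auto
    then show ?thesis using \<open>1 \<le> k\<close> by simp
  next
    case (Suc n)
    then have "K N \<subseteq> insert N (K n)" by (auto simp: K_def le_Suc_eq)
    then have "card (K N) \<le> card (insert N (K n))" using finK by (intro card_mono) auto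
    also have "\<dots> \<le> Suc (card (K n))" by (rule card_insert_le_m1) auto
    finally show ?thesis using before[of n] Suc by simp
  qed
  moreover have "{i. coeff (taylor_poly a N) i \<noteq> 0} = K N"
    by (auto simp: coeff_taylor_poly K_def)
  ultimately have "card {i. coeff (taylor_poly a N) i \<noteq> 0} = k" using kN by simp
  moreover have "\<forall>j\<le>N. has_nth_derivative j f S 0 (a j)" using a NL by simp
  ultimately show ?thesis
    using that peano_small_taylor_poly[where a = a and N = N and f = f and S = S] S aN by blast
qed

section \<open>The rank-one characterization\<close>

lemma interval_properties:
  fixes R :: ereal and I :: "real set"
  assumes "0 < R"
    and "I = {x. 0 \<le> x \<and> ereal x < R} \<or> I = {x. - R < ereal x \<and> ereal x < R}"
  shows "convex I" and "0 \<in> I" and "\<exists>r>0. {0..<r} \<subseteq> I" and "y \<in> I \<Longrightarrow> at y within I \<noteq> bot"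
proof -
  show zero: "0 \<in> I" using assms by (cases R) auto
  have "is_interval I"
    unfolding is_interval_1 using assms(2)
    by (auto intro: le_less_trans less_le_trans simp: ereal_less_eq(3)[symmetric] simp del: ereal_less_eq(3))
  then show conv: "convex I" by (rule is_interval_convex)
  obtain r where "0 < ereal r" "ereal r < R" using ereal_dense2[OF assms(1)] by blast
  have "{0..<r} \<subseteq> I"
  proof
    fix x assume "x \<in> {0..<r}"
    then have "0 \<le> x" "ereal x < R" using \<open>ereal r < R\<close> by (cases R; auto)+
    moreover have "- R < ereal x" using assms(1) \<open>0 \<le> x\<close>
      by (cases R) auto
    ultimately show "x \<in> I" using assms(2) by auto
  qed
  moreover have "0 < r" using \<open>0 < ereal r\<close> by simp
  ultimately show r: "\<exists>r>0. {0..<r} \<subseteq> I" by blast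
  have "r / 2 \<in> I" using \<open>{0..<r} \<subseteq> I\<close> \<open>0 < r\<close> by auto
  then have "I \<noteq> {z}" for z using zero \<open>0 < r\<close> by auto
  then have "y islimpt I" if "y \<in> I"
    using connected_imp_perfect convex_connected[OF conv] that by metis
  then show "at y within I \<noteq> bot" if "y \<in> I"
    using that trivial_limit_within by blast
qed

lemma two_sided_interval_room:
  fixes R :: ereal
  assumes "- R < ereal x" and "ereal x < R"
  shows "\<exists>r>\<bar>x\<bar>. {- r<..<r} \<subseteq> {x. - R < ereal x \<and> ereal x < R}"
proof -
  have "ereal \<bar>x\<bar> < R" using assms by (cases R) auto
  then obtain r where r: "ereal \<bar>x\<bar> < ereal r" "ereal r < R" using ereal_dense2 by blast
  have "{- r<..<r} \<subseteq> {x. - R < ereal x \<and> ereal x < R}"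
    using r(2) by (cases R) auto
  then show ?thesis using r(1) by auto
qed

text \<open>
  The Taylor polynomial at order \<open>m (n - 1)\<close>, with the missing orders filled in by zero
  derivatives, has \<open>n - 1\<close> terms; this leaves one far coordinate.
\<close>
lemma psd_forces_positive_expansion:
  fixes f :: "real \<Rightarrow> real" and m :: "nat \<Rightarrow> nat" and d :: "nat \<Rightarrow> real"
  assumes S: "convex I" "0 \<in> I" "\<And>y. y \<in> I \<Longrightarrow> at y within I \<noteq> bot" and r: "0 < r" "{0..<r} \<subseteq> I"
    and n: "2 \<le> CARD('n::finite)" and mono: "strict_mono_on {1..CARD('n) - 1} m"
    and d: "\<forall>i\<in>{1..CARD('n) - 1}. has_nth_derivative (m i) f I 0 (d i) \<and> d i \<noteq> 0"
    and gaps: "\<forall>j < m (CARD('n) - 1). j \<notin> m ` {1..CARD('n) - 1} \<longrightarrow> has_nth_derivative j f I 0 0"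
    and psd: "entrywise f \<in> (psd_mats_rank_le 1 I :: (real^'n^'n) set) \<rightarrow> psd_mats UNIV"
  shows "\<forall>i\<in>{1..CARD('n) - 1}. 0 < d i / fact (m i)"
    and "\<exists>h :: real \<Rightarrow> real.
      (\<forall>x\<in>I. f x = (\<Sum>i = 1..CARD('n) - 1. d i / fact (m i) * x ^ m i)
                    + x ^ m (CARD('n) - 1) * h x) \<and>
      h 0 = 0 \<and> (\<forall>x\<in>I. 0 \<le> x \<longrightarrow> 0 \<le> h x)"
proof -
  define E where "E = {1..CARD('n) - 1}"
  define N where "N = m (CARD('n) - 1)"
  have last: "CARD('n) - 1 \<in> E" using n by (simp add: E_def)
  have mN: "m i \<le> N" if "i \<in> E" for i
    using strict_mono_on_leD[OF mono] that last by (simp add: E_def N_def)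
  have inj: "inj_on m E" using strict_mono_on_imp_inj_on[OF mono] by (simp add: E_def)
  define a where "a j = (if j \<in> m ` E then d (the_inv_into E m j) else 0)" for j
  have am: "a (m i) = d i" if "i \<in> E" for i
    using that inj by (simp add: a_def the_inv_into_f_f)
  have a0: "a j = 0" if "j \<notin> m ` E" for j using that by (simp add: a_def)
  have der: "\<forall>j\<le>N. has_nth_derivative j f I 0 (a j)"
  proof (intro allI impI)
    fix j assume "j \<le> N"
    show "has_nth_derivative j f I 0 (a j)"
    proof (cases "j \<in> m ` E")
      case True
      then show ?thesis using d am by (auto simp: E_def)
    next
      case False
      then have "j \<noteq> N" using last by (auto simp: N_def)
      then have "j < N" using \<open>j \<le> N\<close> by simp
      then show ?thesis using gaps False a0[OF False] by (auto simp: E_def N_def)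
    qed
  qed
  have aN: "a N \<noteq> 0" using am[OF last] d last by (auto simp: N_def E_def)
  define p where "p = taylor_poly a N"
  have small: "peano_small (degree p) I (\<lambda>x. f x - poly p x)"
    unfolding p_def using peano_small_taylor_poly[where a = a and N = N and f = f and S = I] S der aN
    by blast
  have coeff_m: "coeff p (m i) = d i / fact (m i)" if "i \<in> E" for i
    using mN[OF that] am[OF that] by (simp add: p_def coeff_taylor_poly)
  have supp: "{i. coeff p i \<noteq> 0} = m ` E"
  proof -
    have "coeff p j \<noteq> 0 \<longleftrightarrow> j \<in> m ` E" for j
      using mN am a0[of j] d by (auto simp: p_def coeff_taylor_poly E_def)
    then show ?thesis by blast
  qed
  have poly_p: "poly p x = (\<Sum>i = 1..CARD('n) - 1. d i / fact (m i) * x ^ m i)" for x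
    unfolding poly_eq_sum_support supp sum.reindex[OF inj] E_def[symmetric]
    by (rule sum.cong) (simp_all add: coeff_m)
  have "card {i. coeff p i \<noteq> 0} < CARD('n)"
    unfolding supp card_image[OF inj] using n by (simp add: E_def)
  note pos = psd_forces_positive_taylor[OF small r psd this]
  show "\<forall>i\<in>{1..CARD('n) - 1}. 0 < d i / fact (m i)"
  proof
    fix i assume i: "i \<in> {1..CARD('n) - 1}"
    then have "0 \<le> d i / fact (m i)" "d i \<noteq> 0"
      using pos(1)[of "m i"] coeff_m[of i] d by (simp_all add: E_def)
    then show "0 < d i / fact (m i)" by (simp add: less_le)
  qed
  define h where "h x = (f x - poly p x) / x ^ N" for x
  have "f x = poly p x + x ^ N * h x" for x
  proof (cases "x = 0")
    case True
    then show ?thesis using small by (simp add: peano_small_def h_def)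
  next
    case False
    then show ?thesis by (simp add: h_def)
  qed
  moreover have "h 0 = 0" using small by (simp add: peano_small_def h_def)
  moreover have "0 \<le> h x" if "x \<in> I" "0 \<le> x" for x
    using pos(2)[OF that] that(2) by (simp add: h_def)
  ultimately show "\<exists>h :: real \<Rightarrow> real.
      (\<forall>x\<in>I. f x = (\<Sum>i = 1..CARD('n) - 1. d i / fact (m i) * x ^ m i)
                    + x ^ m (CARD('n) - 1) * h x) \<and>
      h 0 = 0 \<and> (\<forall>x\<in>I. 0 \<le> x \<longrightarrow> 0 \<le> h x)"
    unfolding poly_p[symmetric] N_def[symmetric] by blast
qed

theorem theorem1:
  fixes R :: ereal and I :: "real set" and f :: "real \<Rightarrow> real" and k :: nat
  assumes "0 < R"
    and "I = {x. 0 \<le> x \<and> ereal x < R} \<or> I = {x. - R < ereal x \<and> ereal x < R}"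
    and "1 \<le> k" and "k < CARD('n::finite)"
    and "\<exists>M. finite M \<and> card M = k \<and> (\<forall>m\<in>M. \<exists>D. has_nth_derivative m f I 0 D \<and> D \<noteq> 0)"
  shows
    "((polynomial_with_coeffs k I f \<longrightarrow>
         entrywise f \<in> (psd_mats_rank_le 1 I :: (real^'n^'n) set) \<rightarrow> sym_mats_rank_le k UNIV) \<and>
      (I = {x. 0 \<le> x \<and> ereal x < R} \<or> CARD('n) \<noteq> 2 \<longrightarrow>
         (entrywise f \<in> (psd_mats_rank_le 1 I :: (real^'n^'n) set) \<rightarrow> sym_mats_rank_le k UNIV \<longleftrightarrow>
          polynomial_with_coeffs k I f))) \<and>
     ((polynomial_with_pos_coeffs k I f \<longrightarrow>
         entrywise f \<in> (psd_mats_rank_le 1 I :: (real^'n^'n) set) \<rightarrow> psd_mats_rank_le k UNIV) \<and>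
      (I = {x. 0 \<le> x \<and> ereal x < R} \<or> CARD('n) \<noteq> 2 \<longrightarrow>
         (entrywise f \<in> (psd_mats_rank_le 1 I :: (real^'n^'n) set) \<rightarrow> psd_mats_rank_le k UNIV \<longleftrightarrow>
          polynomial_with_pos_coeffs k I f))) \<and>
     (\<forall>(m :: nat \<Rightarrow> nat) (d :: nat \<Rightarrow> real).
        strict_mono_on {1..CARD('n) - 1} m \<and>
        (\<forall>i\<in>{1..CARD('n) - 1}. has_nth_derivative (m i) f I 0 (d i) \<and> d i \<noteq> 0) \<and>
        (\<forall>j < m (CARD('n) - 1). j \<notin> m ` {1..CARD('n) - 1} \<longrightarrow> has_nth_derivative j f I 0 0) \<and>
        entrywise f \<in> (psd_mats_rank_le 1 I :: (real^'n^'n) set) \<rightarrow> psd_mats UNIV \<longrightarrow>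
        (\<forall>i\<in>{1..CARD('n) - 1}. 0 < d i / fact (m i)) \<and>
        (\<exists>h :: real \<Rightarrow> real.
           (\<forall>x\<in>I. f x = (\<Sum>i = 1..CARD('n) - 1. d i / fact (m i) * x ^ m i)
                         + x ^ m (CARD('n) - 1) * h x) \<and>
           h 0 = 0 \<and>
           h ` {x. 0 \<le> x \<and> ereal x < R} \<subseteq> {0..}))"
proof -
  note I = interval_properties[OF assms(1,2)]
  obtain r where r: "0 < r" "{0..<r} \<subseteq> I" using I(3) by blast
  obtain M where M: "finite M" "card M = k" "\<forall>m\<in>M. \<exists>D. has_nth_derivative m f I 0 D \<and> D \<noteq> 0"
    using assms(5) by blast
  obtain p where p: "card {i. coeff p i \<noteq> 0} = k"
    and small: "peano_small (degree p) I (\<lambda>x. f x - poly p x)"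
    using taylor_polynomial_with_k_terms[OF I(1,2,4) M assms(3)] by blast
  have unique: "\<forall>x\<in>I. f x = poly p x"
    if case_ok: "I = {x. 0 \<le> x \<and> ereal x < R} \<or> CARD('n) \<noteq> 2"
      and rank: "entrywise f \<in> (psd_mats_rank_le 1 I :: (real^'n^'n) set) \<rightarrow> sym_mats_rank_le k UNIV"
  proof (cases "I = {x. 0 \<le> x \<and> ereal x < R}")
    case True
    then show ?thesis
      using rank_forces_taylor_polynomial_nonneg[OF small r rank p assms(4)] by blast
  next
    case False
    then have I_eq: "I = {x. - R < ereal x \<and> ereal x < R}" using assms(2) by blast
    have room: "\<exists>r>\<bar>x\<bar>. {- r<..<r} \<subseteq> I" if "x \<in> I" for x
      using two_sided_interval_room[of R x] that unfolding I_eq by blast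
    have "3 \<le> CARD('n)" using False case_ok assms(3,4) by auto
    then show ?thesis
      using rank_forces_taylor_polynomial_two_sided[OF small I(2) room rank p assms(3,4)] by blast
  qed
  have part1: "polynomial_with_coeffs k I f"
    if "I = {x. 0 \<le> x \<and> ereal x < R} \<or> CARD('n) \<noteq> 2"
      "entrywise f \<in> (psd_mats_rank_le 1 I :: (real^'n^'n) set) \<rightarrow> sym_mats_rank_le k UNIV"
    using unique[OF that] p unfolding polynomial_with_coeffs_def by blast
  have part2: "polynomial_with_pos_coeffs k I f"
    if case_ok: "I = {x. 0 \<le> x \<and> ereal x < R} \<or> CARD('n) \<noteq> 2"
      and psd: "entrywise f \<in> (psd_mats_rank_le 1 I :: (real^'n^'n) set) \<rightarrow> psd_mats_rank_le k UNIV"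
  proof -
    have "entrywise f \<in> (psd_mats_rank_le 1 I :: (real^'n^'n) set) \<rightarrow> sym_mats_rank_le k UNIV"
      using psd by (auto simp: psd_mats_rank_le_def psd_mats_def sym_mats_rank_le_def)
    then have "\<forall>x\<in>I. f x = poly p x" by (rule unique[OF case_ok])
    moreover have "entrywise f \<in> (psd_mats_rank_le 1 I :: (real^'n^'n) set) \<rightarrow> psd_mats UNIV"
      using psd by (auto simp: psd_mats_rank_le_def)
    then have "0 \<le> coeff p i" for i
      using psd_forces_positive_taylor(1)[OF small r] p assms(4) by blast
    then have "\<forall>i. coeff p i \<noteq> 0 \<longrightarrow> coeff p i > 0" by (simp add: less_le)
    ultimately show ?thesis using p unfolding polynomial_with_pos_coeffs_def by blast
  qed
  have part3: "(\<forall>i\<in>{1..CARD('n) - 1}. 0 < d i / fact (m i)) \<and>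
        (\<exists>h :: real \<Rightarrow> real.
           (\<forall>x\<in>I. f x = (\<Sum>i = 1..CARD('n) - 1. d i / fact (m i) * x ^ m i)
                         + x ^ m (CARD('n) - 1) * h x) \<and>
           h 0 = 0 \<and>
           h ` {x. 0 \<le> x \<and> ereal x < R} \<subseteq> {0..})"
    if hyps: "strict_mono_on {1..CARD('n) - 1} m"
      "\<forall>i\<in>{1..CARD('n) - 1}. has_nth_derivative (m i) f I 0 (d i) \<and> d i \<noteq> 0"
      "\<forall>j < m (CARD('n) - 1). j \<notin> m ` {1..CARD('n) - 1} \<longrightarrow> has_nth_derivative j f I 0 0"
      "entrywise f \<in> (psd_mats_rank_le 1 I :: (real^'n^'n) set) \<rightarrow> psd_mats UNIV"
    for m d
  proof -
    have n: "2 \<le> CARD('n)" using assms(3,4) by simp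
    have sub: "{x. 0 \<le> x \<and> ereal x < R} \<subseteq> I"
    proof
      fix x assume "x \<in> {x. 0 \<le> x \<and> ereal x < R}"
      then have "- R < ereal x" "0 \<le> x" "ereal x < R" using assms(1) by (cases R; auto)+
      then show "x \<in> I" using assms(2) by auto
    qed
    note concl = psd_forces_positive_expansion[OF I(1,2,4) r n hyps]
    obtain h :: "real \<Rightarrow> real" where h: "\<forall>x\<in>I. f x = (\<Sum>i = 1..CARD('n) - 1. d i / fact (m i) * x ^ m i)
                         + x ^ m (CARD('n) - 1) * h x" "h 0 = 0" "\<forall>x\<in>I. 0 \<le> x \<longrightarrow> 0 \<le> h x"
      using concl(2) by blast
    have "h ` {x. 0 \<le> x \<and> ereal x < R} \<subseteq> {0..}" using h(3) sub by auto
    then show ?thesis using concl(1) h(1,2) by blast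
  qed
  show ?thesis
    by (intro conjI impI iffI allI; (elim conjE)?;
        (rule polynomial_gives_rank positive_polynomial_gives_psd part1 part2
          conjunct1[OF part3] conjunct2[OF part3]; assumption))
qed

end
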